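(* Let $E\in V(\mathcal T_h)$ be the unique solution of $a(E,F)=L(F)$ for all $F\in V(\mathcal T_h)$. Let $i\ge1$, let $\epsilon_1,\dots,\epsilon_i\in(0,1)$, and let $E_0,E_1,\dots,E_i$ and $\varphi_1^{NN},\dots,\varphi_i^{NN}$ be generated by the recursive discontinuous Galerkin plane wave neural network procedure described in the context. Assume that $|||E-E_{j-1}|||>0$ for $j=1,\dots,i$, and that for each $j=1,\dots,i$ the integer $n_j=n(\epsilon_j,E_{j-1})\in\mathbb N$ and the function $\varphi_j^{NN}\in V_{n_j}^\sigma(\mathcal T_h)\cap B$ are such that $\varphi_j^{NN}$ is a quasi-maximizer of $\langle r(E_{j-1}),\cdot\rangle$ associated with $\epsilon_j$ and $$\Big|\Big|\Big|\varphi_j^{NN}-\frac{E-E_{j-1}}{|||E-E_{j-1}|||}\Big|\Big|\Big|\le\epsilon_j .$$ Then $$|||E-E_i|||<|||E-E_0|||\prod_{j=1}^i\epsilon_j .$$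
   Context: Maxwell setting. $\Omega\subset\mathbb R^3$ is a bounded polyhedral domain with boundary $\gamma$ and outward unit normal $n$; $\omega>0$; $g\in L^2_T(\partial\Omega)^3$ (square-integrable tangential fields). The underlying problem is $\nabla\times(\frac1{\mathrm i\omega\mu}\nabla\times E)+\mathrm i\omega\varepsilon E=0$ in $\Omega$, $-E\times n+\frac{\varsigma}{\mathrm i\omega\mu}((\nabla\times E)\times n)\times n=g$ on $\gamma$, with piecewise constant coefficients $\varepsilon$ (possibly complex), $\mu$, $\varsigma$, constant on each element. $\mathcal T_h=\{\Omega_1,\dots,\Omega_N\}$ is a finite element partition of $\Omega$, $\Gamma_{kj}=\partial\Omega_k\cap\partial\Omega_j$, $\gamma_k=\overline\Omega_k\cap\partial\Omega$, $n_k$ is the outward unit normal to $\Omega_k$. $V(\Omega_k)=\{E_k\in H(\mathrm{curl};\Omega_k): \nabla\times(\frac1{\mathrm i\omega\mu}\nabla\times E_k)+\mathrm i\omega\varepsilon E_k=0 \text{ in }\Omega_k\}$ and $V(\mathcal T_h)=\{v\in L^2(\Omega)^3: v|_{\Omega_k}\in V(\Omega_k)\ \forall k\}$; fields are understood to have square-integrable tangential traces (of themselves and of their curls) on the element boundaries, so that the forms below are finite. Tangential jump on $\Gamma_{kj}$: $[\![F\times n]\!]=F_k\times n_k+F_j\times n_j$. For fixed positive constants $\rho_1,\rho_2$, writing $\mathcal B_k(F)=-F_k\times n_k+\frac{\varsigma}{\mathrm i\omega\mu}((\nabla\times F_k)\times n_k)\times n_k$ on $\gamma_k$, $$a(E,F)=\sum_{k<j}\int_{\Gamma_{kj}}\Big(\rho_1[\![E\times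 n]\!]\cdot\overline{[\![F\times n]\!]}+\rho_2\big[\!\big[\tfrac1{\mathrm i\omega\mu}(\nabla\times E)\times n\big]\!\big]\cdot\overline{\big[\!\big[\tfrac1{\mathrm i\omega\mu}(\nabla\times F)\times n\big]\!\big]}\Big)ds+\sum_{k=1}^N\int_{\gamma_k}\mathcal B_k(E)\cdot\overline{\mathcal B_k(F)}\,ds,$$ $$L(F)=\sum_{k=1}^N\int_{\gamma_k}g\cdot\overline{\mathcal B_k(F)}\,ds.$$ $|||F|||=a(F,F)^{1/2}$ is a norm on $V(\mathcal T_h)$, $B$ is the closed unit ball of $V(\mathcal T_h)$ in this norm, and the variational problem $a(E,F)=L(F)$ for all $F\in V(\mathcal T_h)$ has a unique solution $E\in V(\mathcal T_h)$. Plane wave network set $V_n^\sigma(\mathcal T_h)$, $n=m^*t^*$ with positive integers $m^*,t^*$ (with $t^*\approx2m^*$): all $\varphi$ such that on each $\Omega_k$ $$\varphi|_{\Omega_k}=\sum_{m=1}^{m^*}\sum_{t=1}^{t^*}\big(c_l^{(k)}E_l^{(k)}+c_{l+n}^{(k)}E_{l+n}^{(k)}\big),\quad l=(m-1)t^*+t,$$ with $c_l^{(k)},c_{l+n}^{(k)}\in\mathbb C$, where $E_l^{(k)}=\sqrt\mu\,G_l^{(k)}e^{\mathrm i\kappa W_l^{(k)}\cdot x}$, $E_{l+n}^{(k)}=\sqrt\mu\,(G_l^{(k)}\times W_l^{(k)})e^{\mathrm i\kappa W_l^{(k)}\cdot x}$, $\kappa=\omega\sqrt{\mu\varepsilon}$,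 $W_l^{(k)}=(\sin\zeta_m^{(k)}\cos\vartheta_t^{(k)},\sin\zeta_m^{(k)}\sin\vartheta_t^{(k)},\cos\zeta_m^{(k)})^T=:(a_l,b_l,c_l)^T$ with arbitrary angles $\zeta_m^{(k)}\in[0,\pi]$, $\vartheta_t^{(k)}\in(-\pi,\pi]$, and $G_l^{(k)}$ is a real unit vector orthogonal to $W_l^{(k)}$, for $|b_l|<1$ chosen as $G_l^{(k)}=\big(\frac{a_lb_l}{\sqrt{1-b_l^2}},-\sqrt{1-b_l^2},\frac{-a_l^2b_l+b_l(1-b_l^2)}{c_l\sqrt{1-b_l^2}}\big)^T$ (third entry equal to $b_lc_l/\sqrt{1-b_l^2}$). Residual functional: $\langle r(E'),F\rangle=\mathrm{Re}\{L(F)-a(E',F)\}=\mathrm{Re}\{a(E-E',F)\}$. Quasi-maximizer: $\varphi_j^{NN}\in V_{n_j}^\sigma(\mathcal T_h)\cap B$ is a quasi-maximizer of $\langle r(E_{j-1}),\cdot\rangle$ associated with $\epsilon_j$ if $\langle r(E_{j-1}),\varphi_j^{NN}\rangle\ge\sup_{v\in V_{n_j}^\sigma(\mathcal T_h)\cap B}\langle r(E_{j-1}),v\rangle-\epsilon_j|||E-E_{j-1}|||$. Recursive procedure: $E_0=0$. Given $E_{j-1}$, a quasi-maximizer $\varphi_j^{NN}$ of $\langle r(E_{j-1}),\cdot\rangle$, normalized so that $|||\varphi_j^{NN}|||=1$, is chosen; put $\Phi_j^{NN}=\mathrm{span}\{\varphi_1^{NN},\dots,\varphi_j^{NN}\}$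 (complex span), and let $E_j\in\Phi_j^{NN}$ satisfy $a(E_j,F)=L(F)$ for all $F\in\Phi_j^{NN}$. *)

theory Defs
  imports "HOL-Analysis.Analysis"
begin

type_synonym point = "real ^ 3"
type_synonym cvec3 = "complex ^ 3"
type_synonym field3 = "real ^ 3 \<Rightarrow> complex ^ 3"

subsection \<open>Vector algebra in three complex dimensions\<close>

definition cvec :: "point \<Rightarrow> cvec3" where
  "cvec v = (\<chi> i. complex_of_real (v $ i))"

text \<open>The bilinear product, without conjugation. The Hermitian product of \<open>u\<close> and \<open>v\<close> is
  \<open>cdot u (vcnj v)\<close>.\<close>

definition cdot :: "cvec3 \<Rightarrow> cvec3 \<Rightarrow> complex" where
  "cdot u v = (\<Sum>i\<in>UNIV. u $ i * v $ i)"

definition vcnj :: "cvec3 \<Rightarrow> cvec3" where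
  "vcnj v = (\<chi> i. cnj (v $ i))"

definition ccross :: "cvec3 \<Rightarrow> cvec3 \<Rightarrow> cvec3" where
  "ccross u v = vector [u$2 * v$3 - u$3 * v$2, u$3 * v$1 - u$1 * v$3, u$1 * v$2 - u$2 * v$1]"

subsection \<open>Surface measure\<close>

text \<open>The area measure of a plane \<open>P\<close>: the area of a set \<open>A \<subseteq> P\<close> is the volume of the right
  cylinder of height 1 over \<open>A\<close> (and centred at \<open>P\<close>), that is, of the set of the points of the slab
  of thickness 1 around \<open>P\<close> whose orthogonal projection to \<open>P\<close> lies in \<open>A\<close>.\<close>

definition plane_area :: "point set \<Rightarrow> point measure" where
  "plane_area P = distr (restrict_space lborel {x. infdist x P \<le> 1 / 2}) borel (closest_point P)"

definition planes :: "point set set" where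
  "planes = {P. affine P \<and> aff_dim P = 2}"

text \<open>Two-dimensional area of sets contained in a union of finitely many planes, such as the boundary of a
  polyhedron: the sum of the areas of the intersections with all planes. Two distinct planes meet in
  a set of area 0, so nothing is counted twice.\<close>

definition area :: "point measure" where
  "area = measure_of UNIV (sets borel) (\<lambda>A. \<integral>\<^sup>+P. emeasure (plane_area P) A \<partial>count_space planes)"

lemma sets_area [simp, measurable_cong]: "sets area = sets borel"
  unfolding area_def by (metis sets.sets_measure_of_eq space_borel)

lemma space_area [simp]: "space area = UNIV"
  unfolding area_def by (rule space_measure_of) simp

lemma emeasure_area:
  assumes A: "A \<in> sets borel"
  shows "emeasure area A = (\<integral>\<^sup>+P. emeasure (plane_area P) A \<partial>count_space planes)"
proof (rule emeasure_measure_of[OF area_def])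
  show "positive (sets area) (\<lambda>A. \<integral>\<^sup>+P. emeasure (plane_area P) A \<partial>count_space planes)"
    by (simp add: positive_def)
  show "countably_additive (sets area) (\<lambda>A. \<integral>\<^sup>+P. emeasure (plane_area P) A \<partial>count_space planes)"
  proof (rule countably_additiveI)
    fix F :: "nat \<Rightarrow> point set"
    assume F: "range F \<subseteq> sets area" "disjoint_family F"
    then have "range F \<subseteq> sets (plane_area P)" for P
      by (auto simp: plane_area_def)
    then have "(\<Sum>i. emeasure (plane_area P) (F i)) = emeasure (plane_area P) (\<Union>i. F i)" for P
      using F(2) by (rule suminf_emeasure)
    then show "(\<Sum>i. \<integral>\<^sup>+P. emeasure (plane_area P) (F i) \<partial>count_space planes)
        = (\<integral>\<^sup>+P. emeasure (plane_area P) (\<Union>i. F i) \<partial>count_space planes)"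
      by (subst nn_integral_suminf[symmetric]) auto
  qed
qed (use A in auto)

subsection \<open>Polyhedral domains and normals\<close>

text \<open>The condition \<open>interior (closure D) = D\<close> excludes slits: near every point of the boundary
  outside a set of area 0, the domain lies on exactly one side of the boundary.\<close>

definition polyhedral_domain :: "point set \<Rightarrow> bool" where
  "polyhedral_domain D \<longleftrightarrow> open D \<and> connected D \<and> D \<noteq> {} \<and> bounded D \<and> interior (closure D) = D \<and>
     (\<exists>\<P>. finite \<P> \<and> (\<forall>Q\<in>\<P>. polytope Q) \<and> closure D = \<Union>\<P>)"

definition is_outward_normal :: "point set \<Rightarrow> point \<Rightarrow> point \<Rightarrow> bool" where
  "is_outward_normal D x \<nu> \<longleftrightarrow> norm \<nu> = 1 \<and> (\<exists>r>0. D \<inter> ball x r = {y \<in> ball x r. \<nu> \<bullet> (y - x) < 0})"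

text \<open>The normal is defined in the relative interior of the faces; it is set to 0 on the edges.\<close>

definition outward_normal :: "point set \<Rightarrow> point \<Rightarrow> point" where
  "outward_normal D x = (if \<exists>\<nu>. is_outward_normal D x \<nu> then THE \<nu>. is_outward_normal D x \<nu> else 0)"

definition normal :: "point set \<Rightarrow> field3" where
  "normal D x = cvec (outward_normal D x)"

subsection \<open>The space \<open>H(curl)\<close> and square integrable tangential traces\<close>

definition square_integrable :: "point measure \<Rightarrow> field3 \<Rightarrow> bool" where
  "square_integrable M F \<longleftrightarrow> F \<in> borel_measurable M \<and> integrable M (\<lambda>x. (norm (F x))\<^sup>2)"

primrec Ck :: "nat \<Rightarrow> field3 \<Rightarrow> bool" where
  "Ck 0 f \<longleftrightarrow> continuous_on UNIV f"
| "Ck (Suc k) f \<longleftrightarrow> (\<exists>f'. (\<forall>x. (f has_derivative f' x) (at x)) \<and> (\<forall>h. Ck k (\<lambda>x. f' x h)))"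

definition smooth_field :: "field3 \<Rightarrow> bool" where
  "smooth_field f \<longleftrightarrow> (\<forall>k. Ck k f)"

definition test_field :: "point set \<Rightarrow> field3 \<Rightarrow> bool" where
  "test_field D f \<longleftrightarrow> smooth_field f \<and> compact (closure {x. f x \<noteq> 0}) \<and> closure {x. f x \<noteq> 0} \<subseteq> D"

definition pderiv3 :: "3 \<Rightarrow> field3 \<Rightarrow> field3" where
  "pderiv3 j v x = frechet_derivative v (at x) (axis j 1)"

definition classical_curl :: "field3 \<Rightarrow> field3" where
  "classical_curl v x = vector [pderiv3 2 v x $ 3 - pderiv3 3 v x $ 2,
                                pderiv3 3 v x $ 1 - pderiv3 1 v x $ 3,
                                pderiv3 1 v x $ 2 - pderiv3 2 v x $ 1]"

text \<open>\<open>F\<close> and its distributional curl \<open>C\<close> are both square integrable on the open set \<open>D\<close>.\<close>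

definition has_curl :: "point set \<Rightarrow> field3 \<Rightarrow> field3 \<Rightarrow> bool" where
  "has_curl D F C \<longleftrightarrow> square_integrable (lebesgue_on D) F \<and> square_integrable (lebesgue_on D) C \<and>
     (\<forall>f. test_field D f \<longrightarrow>
        (\<integral>x. cdot (C x) (f x) \<partial>lebesgue_on D) = (\<integral>x. cdot (F x) (classical_curl f x) \<partial>lebesgue_on D))"

definition Hcurl :: "point set \<Rightarrow> field3 set" where
  "Hcurl D = {F. \<exists>C. has_curl D F C}"

text \<open>A representative: the curl is unique up to equality almost everywhere in \<open>D\<close>.\<close>

definition curl :: "point set \<Rightarrow> field3 \<Rightarrow> field3" where
  "curl D F = (SOME C. has_curl D F C)"

text \<open>The tangential field \<open>T\<close> on the boundary is the trace \<open>F \<times> n\<close> in the sense of Green's formula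
  for the curl, which holds for all test fields that are smooth up to the boundary.\<close>

definition has_trace :: "point set \<Rightarrow> field3 \<Rightarrow> field3 \<Rightarrow> bool" where
  "has_trace D F T \<longleftrightarrow> square_integrable (restrict_space area (frontier D)) T \<and>
     (AE x in restrict_space area (frontier D). cdot (T x) (normal D x) = 0) \<and>
     (\<forall>v. smooth_field v \<longrightarrow>
        (\<integral>x. cdot (F x) (classical_curl v x) - cdot (curl D F x) (v x) \<partial>lebesgue_on D)
          = (\<integral>x. cdot (T x) (v x) \<partial>restrict_space area (frontier D)))"

text \<open>\<open>trace D F\<close> is (a representative of) \<open>F \<times> n\<close>.\<close>

definition trace :: "point set \<Rightarrow> field3 \<Rightarrow> field3" where
  "trace D F = (SOME T. has_trace D F T)"

subsection \<open>The boundary value problem and its discontinuous Galerkin formulation\<close>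

text \<open>The elements are \<open>elem k\<close> for \<open>k \<in> {1..nelem}\<close>; \<open>eps k\<close>, \<open>mu k\<close>, \<open>vsig k\<close> are the values of the
  coefficients on \<open>elem k\<close>.\<close>

record maxwell =
  domain :: "point set"
  nelem :: nat
  elem :: "nat \<Rightarrow> point set"
  freq :: real
  eps :: "nat \<Rightarrow> complex"
  mu :: "nat \<Rightarrow> real"
  vsig :: "nat \<Rightarrow> complex"
  bdata :: field3
  rho1 :: real
  rho2 :: real

definition partition_of :: "point set \<Rightarrow> nat \<Rightarrow> (nat \<Rightarrow> point set) \<Rightarrow> bool" where
  "partition_of D N \<Omega> \<longleftrightarrow> (\<forall>k\<in>{1..N}. polyhedral_domain (\<Omega> k) \<and> \<Omega> k \<subseteq> D) \<and>
     (\<forall>k\<in>{1..N}. \<forall>j\<in>{1..N}. k \<noteq> j \<longrightarrow> \<Omega> k \<inter> \<Omega> j = {}) \<and>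
     closure D = (\<Union>k\<in>{1..N}. closure (\<Omega> k))"

definition admissible :: "maxwell \<Rightarrow> bool" where
  "admissible p \<longleftrightarrow> polyhedral_domain (domain p) \<and> partition_of (domain p) (nelem p) (elem p) \<and>
     freq p > 0 \<and> (\<forall>k\<in>{1..nelem p}. mu p k > 0) \<and> rho1 p > 0 \<and> rho2 p > 0 \<and>
     square_integrable (restrict_space area (frontier (domain p))) (bdata p) \<and>
     (AE x in restrict_space area (frontier (domain p)). cdot (bdata p x) (normal (domain p) x) = 0)"

definition iface :: "maxwell \<Rightarrow> nat \<Rightarrow> nat \<Rightarrow> point set" where
  "iface p k j = frontier (elem p k) \<inter> frontier (elem p j)"

definition bface :: "maxwell \<Rightarrow> nat \<Rightarrow> point set" where
  "bface p k = closure (elem p k) \<inter> frontier (domain p)"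

text \<open>\<open>1 / (i \<omega> \<mu>) curl F\<close> on the element \<open>k\<close>\<close>

definition flux :: "maxwell \<Rightarrow> nat \<Rightarrow> field3 \<Rightarrow> field3" where
  "flux p k F x = (1 / (\<i> * of_real (freq p) * of_real (mu p k))) *s curl (elem p k) F x"

definition local_space :: "maxwell \<Rightarrow> nat \<Rightarrow> field3 set" where
  "local_space p k = {F \<in> Hcurl (elem p k).
     has_curl (elem p k) (flux p k F) (\<lambda>x. - ((\<i> * of_real (freq p) * eps p k) *s F x)) \<and>
     (\<exists>T. has_trace (elem p k) F T) \<and> (\<exists>T. has_trace (elem p k) (curl (elem p k) F) T)}"

definition trefftz_space :: "maxwell \<Rightarrow> field3 set" where
  "trefftz_space p = {F. square_integrable (lebesgue_on (domain p)) F \<and>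
     (\<forall>k\<in>{1..nelem p}. F \<in> local_space p k)}"

definition jump :: "maxwell \<Rightarrow> nat \<Rightarrow> nat \<Rightarrow> field3 \<Rightarrow> field3" where
  "jump p k j F x = trace (elem p k) F x + trace (elem p j) F x"

definition flux_jump :: "maxwell \<Rightarrow> nat \<Rightarrow> nat \<Rightarrow> field3 \<Rightarrow> field3" where
  "flux_jump p k j F x = trace (elem p k) (flux p k F) x + trace (elem p j) (flux p j F) x"

definition impedance :: "maxwell \<Rightarrow> nat \<Rightarrow> field3 \<Rightarrow> field3" where
  "impedance p k F x = - trace (elem p k) F x +
     (vsig p k / (\<i> * of_real (freq p) * of_real (mu p k))) *s
       ccross (trace (elem p k) (curl (elem p k) F) x) (normal (elem p k) x)"

definition aform :: "maxwell \<Rightarrow> field3 \<Rightarrow> field3 \<Rightarrow> complex" where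
  "aform p E F =
     (\<Sum>j\<in>{1..nelem p}. \<Sum>k\<in>{1..<j}. \<integral>x.
          of_real (rho1 p) * cdot (jump p k j E x) (vcnj (jump p k j F x))
        + of_real (rho2 p) * cdot (flux_jump p k j E x) (vcnj (flux_jump p k j F x))
        \<partial>restrict_space area (iface p k j))
   + (\<Sum>k\<in>{1..nelem p}. \<integral>x. cdot (impedance p k E x) (vcnj (impedance p k F x))
        \<partial>restrict_space area (bface p k))"

definition Lform :: "maxwell \<Rightarrow> field3 \<Rightarrow> complex" where
  "Lform p F = (\<Sum>k\<in>{1..nelem p}. \<integral>x. cdot (bdata p x) (vcnj (impedance p k F x))
     \<partial>restrict_space area (bface p k))"

text \<open>\<open>aform p F F\<close> is real and nonnegative.\<close>

definition dgnorm :: "maxwell \<Rightarrow> field3 \<Rightarrow> real" where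
  "dgnorm p F = sqrt (Re (aform p F F))"

definition dgball :: "maxwell \<Rightarrow> field3 set" where
  "dgball p = {F \<in> trefftz_space p. dgnorm p F \<le> 1}"

definition solves :: "maxwell \<Rightarrow> field3 set \<Rightarrow> field3 \<Rightarrow> bool" where
  "solves p V E \<longleftrightarrow> E \<in> V \<and> (\<forall>F\<in>V. aform p E F = Lform p F)"

text \<open>Fields are represented by functions, hence uniqueness is up to equality almost everywhere.\<close>

definition unique_solution :: "maxwell \<Rightarrow> field3 \<Rightarrow> bool" where
  "unique_solution p E \<longleftrightarrow> solves p (trefftz_space p) E \<and>
     (\<forall>E'. solves p (trefftz_space p) E' \<longrightarrow> (AE x in lebesgue_on (domain p). E' x = E x))"

subsection \<open>Plane wave networks\<close>

definition direction :: "real \<Rightarrow> real \<Rightarrow> point" where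
  "direction \<zeta> \<theta> = vector [sin \<zeta> * cos \<theta>, sin \<zeta> * sin \<theta>, cos \<zeta>]"

text \<open>The third entry \<open>b c / sqrt (1 - b\<^sup>2)\<close> is \<open>(- a\<^sup>2 b + b (1 - b\<^sup>2)) / (c sqrt (1 - b\<^sup>2))\<close> for
  \<open>c \<noteq> 0\<close>, because \<open>(a, b, c)\<close> is a unit vector. For \<open>b = 1\<close> and \<open>b = - 1\<close> any choice is allowed.\<close>

definition polarization :: "point \<Rightarrow> point \<Rightarrow> bool" where
  "polarization W G \<longleftrightarrow> norm G = 1 \<and> G \<bullet> W = 0 \<and>
     (\<bar>W$2\<bar> < 1 \<longrightarrow>
        G = vector [W$1 * W$2 / sqrt (1 - (W$2)\<^sup>2), - sqrt (1 - (W$2)\<^sup>2), W$2 * W$3 / sqrt (1 - (W$2)\<^sup>2)])"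

definition wavenumber :: "maxwell \<Rightarrow> nat \<Rightarrow> complex" where
  "wavenumber p k = of_real (freq p) * csqrt (of_real (mu p k) * eps p k)"

text \<open>The plane wave on element \<open>k\<close> with direction \<open>W\<close> and amplitude \<open>sqrt \<mu> A\<close>\<close>

definition plane_wave :: "maxwell \<Rightarrow> nat \<Rightarrow> point \<Rightarrow> point \<Rightarrow> field3" where
  "plane_wave p k W A x =
     (of_real (sqrt (mu p k)) * exp (\<i> * wavenumber p k * of_real (W \<bullet> x))) *s cvec A"

text \<open>The network set of width \<open>n = ms * ts\<close>. The angles, the polarizations and the coefficients are
  free on each element.\<close>

definition plane_wave_net :: "maxwell \<Rightarrow> nat \<Rightarrow> nat \<Rightarrow> field3 set" where
  "plane_wave_net p ms ts = {\<phi>. \<forall>k\<in>{1..nelem p}. \<exists>\<zeta> \<theta> G c.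
     (\<forall>m\<in>{1..ms}. \<zeta> m \<in> {0..pi}) \<and> (\<forall>t\<in>{1..ts}. \<theta> t \<in> {-pi<..pi}) \<and>
     (\<forall>m\<in>{1..ms}. \<forall>t\<in>{1..ts}. polarization (direction (\<zeta> m) (\<theta> t)) (G ((m - 1) * ts + t))) \<and>
     (\<forall>x\<in>elem p k. \<phi> x = (\<Sum>m\<in>{1..ms}. \<Sum>t\<in>{1..ts}.
        let l = (m - 1) * ts + t; W = direction (\<zeta> m) (\<theta> t) in
          c l *s plane_wave p k W (G l) x + c (l + ms * ts) *s plane_wave p k W (cross3 (G l) W) x))}"

subsection \<open>The recursive procedure\<close>

definition residual :: "maxwell \<Rightarrow> field3 \<Rightarrow> field3 \<Rightarrow> real" where
  "residual p E' F = Re (Lform p F - aform p E' F)"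

definition quasi_maximizer :: "maxwell \<Rightarrow> field3 \<Rightarrow> field3 set \<Rightarrow> real \<Rightarrow> field3 \<Rightarrow> field3 \<Rightarrow> bool" where
  "quasi_maximizer p E V \<delta> E' \<phi> \<longleftrightarrow> \<phi> \<in> V \<inter> dgball p \<and>
     residual p E' \<phi> \<ge> (SUP v\<in>V \<inter> dgball p. residual p E' v) - \<delta> * dgnorm p (\<lambda>x. E x - E' x)"

definition cspan :: "(nat \<Rightarrow> field3) \<Rightarrow> nat \<Rightarrow> field3 set" where
  "cspan \<phi> j = {F. \<exists>c :: nat \<Rightarrow> complex. F = (\<lambda>x. \<Sum>l\<in>{1..j}. c l *s \<phi> l x)}"

text \<open>\<open>Eh j\<close> and \<open>\<phi> j\<close> are generated by \<open>i\<close> steps of the procedure, with network widths \<open>ms j * ts j\<close>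
  and tolerances \<open>\<epsilon> j\<close>.\<close>

definition dgpwnn :: "maxwell \<Rightarrow> field3 \<Rightarrow> nat \<Rightarrow> (nat \<Rightarrow> real) \<Rightarrow> (nat \<Rightarrow> nat) \<Rightarrow> (nat \<Rightarrow> nat) \<Rightarrow>
    (nat \<Rightarrow> field3) \<Rightarrow> (nat \<Rightarrow> field3) \<Rightarrow> bool" where
  "dgpwnn p E i \<epsilon> ms ts Eh \<phi> \<longleftrightarrow> Eh 0 = (\<lambda>x. 0) \<and>
     (\<forall>j\<in>{1..i}. quasi_maximizer p E (plane_wave_net p (ms j) (ts j)) (\<epsilon> j) (Eh (j - 1)) (\<phi> j) \<and>
        dgnorm p (\<phi> j) = 1 \<and> solves p (cspan \<phi> j) (Eh j))"

end

theory Submission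
  imports Defs "HOL-Computational_Algebra.Polynomial"
begin

text \<open>On the Trefftz space the form \<open>a\<close> is Hermitian and positive semidefinite, so the Galerkin solution
  \<open>E\<^sub>j\<close> is a best approximation of \<open>E\<close> in the span of the first \<open>j\<close> networks. This span contains
  \<open>E\<^bsub>j-1\<^esub> + b \<phi>\<^sub>j\<close> for every \<open>b\<close>, and the optimal \<open>b\<close> reduces the error by the sine of the angle
  between \<open>\<phi>\<^sub>j\<close> and \<open>E - E\<^bsub>j-1\<^esub>\<close>, which is smaller than the distance of the normalized vectors.

  Curls and traces are representatives chosen by \<open>SOME\<close>. Sesquilinearity of \<open>a\<close> therefore rests on
  their uniqueness almost everywhere, which is tested with smooth bumps that converge to the
  indicators of boxes. For the traces this also needs that the boundary of a polyhedron has finite area.\<close>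

subsection \<open>Smooth bumps\<close>

text \<open>For unit vectors at angle t the distance is the chord 2 sin(t/2), while sin t is this
  chord times cos(t/2); this is why the reduction factor falls below \<epsilon>. Only real multiples
  of the new network have to be compared, so everything reduces to the real part of
  \<open>a\<close>, a symmetric form, and to a quadratic polynomial in one real variable. The
  analytic obstacle is that representatives are chosen twice: the flux contains a chosen
  \<open>curl\<close>, and its own curl and trace are chosen again. Each level must therefore be
  insensitive to changes on null sets before linearity can be passed on to the next one. Since
  \<open>smooth_field\<close> demands derivatives of every order, the bumps come from a family of
  functions that is closed under differentiation in closed form. Finite boundary area makes smooth
  fields square integrable there, so that Green's formula can be split by linearity, and it makes
  the surface measure sigma-finite. The impedance term also multiplies a trace by the normal, whose
  measurability comes from local constancy on the faces.\<close>

definition smooth_real :: "(real \<Rightarrow> real) \<Rightarrow> bool" where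
  "smooth_real u \<longleftrightarrow>
     (\<exists>d. d 0 = u \<and> (\<forall>n t. (d n has_real_derivative d (Suc n) t) (at t)))"

text \<open>The tower of derivatives, shifted by one, is a tower for the derivative. This lets
  inductions on the order of differentiability peel off one derivative at a time.\<close>

lemma smooth_realE:
  assumes "smooth_real u"
  obtains v where "smooth_real v" "\<And>t. (u has_real_derivative v t) (at t)"
proof -
  from assms obtain d where d: "d 0 = u" "\<And>n t. (d n has_real_derivative d (Suc n) t) (at t)"
    unfolding smooth_real_def by auto
  have "smooth_real (d 1)"
    unfolding smooth_real_def by (rule exI[of _ "\<lambda>n. d (Suc n)"]) (use d in auto)
  then show ?thesis using d that[of "d 1"] by (metis One_nat_def)
qed

definition flat :: "real poly \<Rightarrow> real \<Rightarrow> real" where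
  "flat q t = (if t > 0 then poly q (1 / t) * exp (- 1 / t) else 0)"

text \<open>With s = 1/t, so ds/dt = - s^2, the derivative of q(s) exp(-s) is s^2 (q(s) - q'(s))
  exp(-s); \<open>[:0, 0, 1:]\<close> is the monomial s^2.\<close>

definition flat_deriv :: "real poly \<Rightarrow> real poly" where
  "flat_deriv q = [:0, 0, 1:] * (q - pderiv q)"

lemma tendsto_poly_div_exp: "((\<lambda>s. poly q s / exp s) \<longlongrightarrow> (0::real)) at_top"
proof -
  have "((\<lambda>s. \<Sum>k\<le>degree q. coeff q k * (s ^ k / exp s)) \<longlongrightarrow> (\<Sum>k\<le>degree q. coeff q k * 0)) at_top"
    by (intro tendsto_intros tendsto_power_div_exp_0)
  then show ?thesis by (simp add: poly_altdef sum_divide_distrib)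
qed

text \<open>This is the difference quotient at 0. On the right the substitution s = 1/t turns it
  into s q(s) / exp s, and \<open>pCons 0 q\<close> is s q(s).\<close>

lemma flat_div_tendsto_0: "((\<lambda>t. flat q t / t) \<longlongrightarrow> 0) (at 0)"
proof -
  have "((\<lambda>s. poly (pCons 0 q) s / exp s) \<longlongrightarrow> 0) at_top"
    by (rule tendsto_poly_div_exp)
  then have "((\<lambda>t. poly (pCons 0 q) (inverse t) / exp (inverse t)) \<longlongrightarrow> 0) (at_right 0)"
    by (rule filterlim_compose[OF _ filterlim_inverse_at_top_right])
  then have R: "((\<lambda>t. flat q t / t) \<longlongrightarrow> 0) (at_right 0)"
    by (rule Lim_transform_eventually)
       (auto simp: flat_def eventually_at_filter exp_minus field_simps)
  have L: "((\<lambda>t. flat q t / t) \<longlongrightarrow> 0) (at_left 0)"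
    by (rule tendsto_eventually) (auto simp: flat_def eventually_at_filter)
  from L R show ?thesis by (simp add: filterlim_at_split)
qed

lemma flat_has_derivative: "(flat q has_real_derivative flat (flat_deriv q) t) (at t)"
proof (cases t "0::real" rule: linorder_cases)
  case less
  have "((\<lambda>t. 0) has_real_derivative 0) (at t)" by simp
  then have "(flat q has_real_derivative 0) (at t)"
    by (rule DERIV_cong_ev[THEN iffD1, rotated -1])
       (use eventually_nhds_in_open[of "{..<0}" t] less in \<open>auto simp: flat_def elim!: eventually_mono\<close>)
  then show ?thesis using less by (simp add: flat_def)
next
  case equal
  then show ?thesis
    using flat_div_tendsto_0[of q] by (simp add: DERIV_def flat_def[of _ 0])
next
  case greater
  have "((\<lambda>t. poly q (1 / t) * exp (- 1 / t)) has_real_derivative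
          poly (flat_deriv q) (1 / t) * exp (- 1 / t)) (at t)"
    using greater
    by (auto intro!: derivative_eq_intros simp: flat_deriv_def power2_eq_square field_simps)
  then have "(flat q has_real_derivative poly (flat_deriv q) (1 / t) * exp (- 1 / t)) (at t)"
    by (rule DERIV_cong_ev[THEN iffD1, rotated -1])
       (use eventually_nhds_in_open[of "{0<..}" t] greater in \<open>auto simp: flat_def elim!: eventually_mono\<close>)
  then show ?thesis using greater by (simp add: flat_def)
qed

lemma smooth_real_flat: "smooth_real (flat q)"
  unfolding smooth_real_def
  by (rule exI[of _ "\<lambda>n. flat ((flat_deriv ^^ n) q)"]) (auto intro: flat_has_derivative)

section \<open>Closure properties of \<open>Ck\<close>\<close>

lemma Ck_zero: "Ck k (\<lambda>x. 0)"
  by (induction k) (auto intro!: exI[of _ "\<lambda>x h. 0"])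

lemma Ck_add: "Ck k f \<Longrightarrow> Ck k g \<Longrightarrow> Ck k (\<lambda>x. f x + g x)"
proof (induction k arbitrary: f g)
  case (Suc k)
  from Suc.prems obtain f' g' where
    "\<And>x. (f has_derivative f' x) (at x)" "\<And>h. Ck k (\<lambda>x. f' x h)"
    "\<And>x. (g has_derivative g' x) (at x)" "\<And>h. Ck k (\<lambda>x. g' x h)" by auto
  then show ?case using Suc.IH
    by (auto intro!: exI[of _ "\<lambda>x h. f' x h + g' x h"] has_derivative_add)
qed (auto intro: continuous_on_add)

lemma Ck_scaleR: "Ck k f \<Longrightarrow> Ck k (\<lambda>x. r *\<^sub>R f x)"
proof (induction k arbitrary: f)
  case (Suc k)
  from Suc.prems obtain f' where
    "\<And>x. (f has_derivative f' x) (at x)" "\<And>h. Ck k (\<lambda>x. f' x h)" by auto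
  then show ?case using Suc.IH
    by (auto intro!: exI[of _ "\<lambda>x h. r *\<^sub>R f' x h"] has_derivative_scaleR_right)
qed (auto intro: continuous_intros)

lemma Ck_sum: "(\<And>i. i \<in> I \<Longrightarrow> Ck k (f i)) \<Longrightarrow> Ck k (\<lambda>x. \<Sum>i\<in>I. f i x)"
  by (induction I rule: infinite_finite_induct) (auto intro: Ck_zero Ck_add)

text \<open>The factors \<open>u i\<close> may differ from each other so that the induction closes:
  the product rule replaces one factor by its derivative and leaves a sum of products of the same
  shape.\<close>

lemma Ck_prod_smooth_real:
  fixes b :: "'i \<Rightarrow> point" and w :: cvec3
  assumes "finite I" "\<And>i. i \<in> I \<Longrightarrow> smooth_real (u i)"
  shows "Ck k (\<lambda>x. (\<Prod>i\<in>I. u i (x \<bullet> b i + s i)) *\<^sub>R w)"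
  using assms(2)
proof (induction k arbitrary: u)
  case 0
  have "continuous_on UNIV (u i)" if "i \<in> I" for i
    using smooth_realE[OF 0(1)[OF that]] by (metis DERIV_continuous_on has_field_derivative_at_within)
  then have "continuous_on UNIV (\<lambda>x. u i (x \<bullet> b i + s i))" if "i \<in> I" for i
    by (rule continuous_on_compose2[of UNIV "u i"]) (use that in \<open>auto intro!: continuous_intros\<close>)
  then show ?case by (auto intro!: continuous_intros)
next
  case (Suc k)
  have "\<exists>v. \<forall>i\<in>I. smooth_real (v i) \<and> (\<forall>t. (u i has_real_derivative v i t) (at t))"
    by (rule bchoice) (metis Suc.prems smooth_realE)
  then obtain v where v: "\<And>i. i \<in> I \<Longrightarrow> smooth_real (v i)"
    "\<And>i t. i \<in> I \<Longrightarrow> (u i has_real_derivative v i t) (at t)" by blast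
  \<comment> \<open>The update \<open>u(j := v j)\<close> writes each term of the product rule as a
    full product over \<open>I\<close>, which is the form the induction hypothesis accepts.\<close>
  define f' where "f' x h = (\<Sum>j\<in>I. (h \<bullet> b j) *\<^sub>R
     ((\<Prod>i\<in>I. (u(j := v j)) i (x \<bullet> b i + s i)) *\<^sub>R w))" for x h
  have "((\<lambda>x. (\<Prod>i\<in>I. u i (x \<bullet> b i + s i)) *\<^sub>R w) has_derivative f' x) (at x)" for x
  proof -
    have *: "((\<lambda>x. u i (x \<bullet> b i + s i)) has_derivative (\<lambda>h. (h \<bullet> b i) * v i (x \<bullet> b i + s i))) (at x)"
      if "i \<in> I" for i
      using has_derivative_compose[OF _ v(2)[OF that, unfolded has_field_derivative_def],
          of "\<lambda>x. x \<bullet> b i + s i" "\<lambda>h. h \<bullet> b i" x UNIV]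
      by (simp add: mult.commute has_derivative_add_const bounded_linear_imp_has_derivative bounded_linear_inner_left)
    have "((\<lambda>x. (\<Prod>i\<in>I. u i (x \<bullet> b i + s i)) *\<^sub>R w) has_derivative
       (\<lambda>h. (\<Sum>j\<in>I. (h \<bullet> b j) * v j (x \<bullet> b j + s j) * (\<Prod>i\<in>I - {j}. u i (x \<bullet> b i + s i))) *\<^sub>R w)) (at x)"
      by (intro has_derivative_scaleR_left has_derivative_prod *)
    also have "(\<lambda>h. (\<Sum>j\<in>I. (h \<bullet> b j) * v j (x \<bullet> b j + s j) * (\<Prod>i\<in>I - {j}. u i (x \<bullet> b i + s i))) *\<^sub>R w) = f' x"
      unfolding f'_def scaleR_sum_left using assms(1)
      by (intro ext sum.cong refl) (auto simp: prod.remove[of I])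
    finally show ?thesis .
  qed
  moreover have "Ck k (\<lambda>x. f' x h)" for h
    unfolding f'_def using Suc.prems v(1) by (intro Ck_sum Ck_scaleR Suc.IH) auto
  ultimately show ?case by auto
qed

text \<open>Each factor is positive exactly on the inner side of one face of the box. The scale
  \<open>Suc n\<close> sends a positive argument to infinity, where exp(-1/t) tends to 1, and it is
  never 0.\<close>

definition bump :: "point \<Rightarrow> point \<Rightarrow> nat \<Rightarrow> point \<Rightarrow> real" where
  "bump a b n x = (\<Prod>e\<in>Basis. flat 1 (real (Suc n) * (x \<bullet> e - a \<bullet> e)) * flat 1 (real (Suc n) * (b \<bullet> e - x \<bullet> e)))"

lemma smooth_field_bump: "smooth_field (\<lambda>x. bump a b n x *\<^sub>R w)"
proof -
  \<comment> \<open>One index per face of the box: \<open>True\<close> marks the lower and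
    \<open>False\<close> the upper face in direction \<open>e\<close>. \<open>B\<close> and
    \<open>s\<close> then give the affine function that vanishes on that face, scaled by
    \<open>Suc n\<close>.\<close>
  define I where "I = (Basis :: point set) \<times> (UNIV :: bool set)"
  define B where "B = (\<lambda>(e::point, p). (if p then real (Suc n) else - real (Suc n)) *\<^sub>R e)"
  define s where "s = (\<lambda>(e::point, p). real (Suc n) * (if p then - (a \<bullet> e) else b \<bullet> e))"
  have "bump a b n x = (\<Prod>i\<in>I. flat 1 (x \<bullet> B i + s i))" for x
  proof -
    have "(\<Prod>i\<in>I. flat 1 (x \<bullet> B i + s i)) = (\<Prod>e\<in>Basis. \<Prod>p\<in>UNIV. flat 1 (x \<bullet> B (e, p) + s (e, p)))"
      unfolding I_def by (simp only: prod.cartesian_product case_prod_unfold prod.collapse)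
    then show ?thesis
      unfolding bump_def by (simp add: B_def s_def UNIV_bool algebra_simps)
  qed
  then show ?thesis
    unfolding smooth_field_def
    using Ck_prod_smooth_real[of I "\<lambda>_. flat 1" _ B s w] smooth_real_flat by (simp add: I_def)
qed

lemma flat_1_bounds: "0 \<le> flat 1 t" "flat 1 t \<le> 1"
  by (auto simp: flat_def)

lemma bump_bounds: "0 \<le> bump a b n x" "bump a b n x \<le> 1"
  unfolding bump_def
  by (auto intro!: prod_nonneg prod_le_1 mult_nonneg_nonneg mult_le_one flat_1_bounds)

lemma bump_eq_0: "x \<notin> box a b \<Longrightarrow> bump a b n x = 0"
  unfolding bump_def mem_box by (auto simp: flat_def zero_less_mult_iff inner_commute)

lemma bump_tendsto: "(\<lambda>n. bump a b n x) \<longlonglongrightarrow> indicator (box a b) x"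
proof (cases "x \<in> box a b")
  case True
  have *: "(\<lambda>n. flat 1 (real (Suc n) * t)) \<longlonglongrightarrow> 1" if "t > 0" for t
  proof -
    have "(\<lambda>n. exp (- (inverse t * inverse (real (Suc n))))) \<longlonglongrightarrow> exp (- (inverse t * 0))"
      by (intro tendsto_intros LIMSEQ_inverse_real_of_nat)
    moreover have "flat 1 (real (Suc n) * t) = exp (- (inverse t * inverse (real (Suc n))))" for n
      using that by (simp add: flat_def divide_inverse)
    ultimately show ?thesis by simp
  qed
  have "(\<lambda>n. bump a b n x) \<longlonglongrightarrow> (\<Prod>e\<in>(Basis::point set). 1 * 1)"
    unfolding bump_def using True by (intro tendsto_intros *) (auto simp: mem_box inner_commute)
  then show ?thesis using True by simp
qed (simp add: bump_eq_0)

lemma continuous_on_bump: "continuous_on UNIV (bump a b n)"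
proof -
  have "continuous_on UNIV (flat q)" for q
    using flat_has_derivative by (metis DERIV_continuous_on has_field_derivative_at_within)
  then have flat: "continuous_on UNIV (\<lambda>x. flat 1 (r x))" if "continuous_on UNIV r" for r :: "point \<Rightarrow> real"
    by (rule continuous_on_compose2[of UNIV "flat 1"]) (use that in auto)
  show ?thesis unfolding bump_def by (intro continuous_on_prod continuous_on_mult flat continuous_on_diff continuous_intros)
qed

lemma bump_measurable [measurable]: "bump a b n \<in> borel_measurable borel"
  by (rule borel_measurable_continuous_onI[OF continuous_on_bump])

text \<open>The support is a closure, so the closed box has to lie in \<open>D\<close>; this
  restriction forces the localization in \<open>AE_zero_if_test_fields\<close>.\<close>

lemma test_field_bump:
  assumes "cbox a b \<subseteq> D"
  shows "test_field D (\<lambda>x. bump a b n x *\<^sub>R w)"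
proof -
  have "{x. bump a b n x *\<^sub>R w \<noteq> 0} \<subseteq> cbox a b"
    using bump_eq_0[of _ a b n] box_subset_cbox by force
  then have "closure {x. bump a b n x *\<^sub>R w \<noteq> 0} \<subseteq> cbox a b"
    by (rule closure_minimal[OF _ closed_cbox])
  with assms show ?thesis
    unfolding test_field_def using smooth_field_bump
    by (auto intro: bounded_subset[OF bounded_cbox] simp: compact_eq_bounded_closed)
qed

text \<open>Dominated convergence: the bumps stay between 0 and 1, so \<open>norm (f x)\<close>
  dominates. Only the Borel structure of \<open>M\<close> matters, hence the same lemma serves
  volume and surface measures.\<close>

lemma box_integral_zero_if_bump:
  fixes f :: "point \<Rightarrow> complex"
  assumes [measurable_cong, simp]: "sets M = sets borel" and f: "integrable M f"
    and 0: "\<And>n. (\<integral>x. bump a b n x *\<^sub>R f x \<partial>M) = 0"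
  shows "(\<integral>x\<in>box a b. f x \<partial>M) = 0"
proof -
  note [measurable] = borel_measurable_integrable[OF f]
  have "(\<lambda>n. \<integral>x. bump a b n x *\<^sub>R f x \<partial>M) \<longlonglongrightarrow> (\<integral>x. indicator (box a b) x *\<^sub>R f x \<partial>M)"
  proof (rule integral_dominated_convergence[where w = "\<lambda>x. norm (f x)"])
    show "AE x in M. (\<lambda>n. bump a b n x *\<^sub>R f x) \<longlonglongrightarrow> indicator (box a b) x *\<^sub>R f x"
      by (intro AE_I2 tendsto_intros bump_tendsto)
    show "AE x in M. norm (bump a b n x *\<^sub>R f x) \<le> norm (f x)" for n
      by (auto intro!: AE_I2 mult_left_le_one_le simp: bump_bounds abs_of_nonneg[OF bump_bounds(1)])
  qed (use f in auto)
  then show ?thesis using 0 by (simp add: set_lebesgue_integral_def LIMSEQ_const_iff)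
qed

text \<open>Open boxes are stable under intersection and generate the Borel sets, so vanishing
  integrals spread to all Borel sets by a Dynkin argument. Sigma-finiteness then turns this into
  vanishing almost everywhere.\<close>

lemma AE_zero_if_box_integrals_zero:
  fixes f :: "point \<Rightarrow> complex"
  assumes "sigma_finite_measure M" and M: "sets M = sets borel" and f: "integrable M f"
    and 0: "\<And>a b. (\<integral>x\<in>box a b. f x \<partial>M) = 0"
  shows "AE x in M. f x = 0"
proof -
  note [measurable_cong, simp] = M
  note [measurable] = borel_measurable_integrable[OF f]
  have si: "set_integrable M A f" if "A \<in> sets borel" for A
    unfolding set_integrable_def using that f by (intro integrable_mult_indicator) auto
  \<comment> \<open>The complement step below needs the integral over the whole space, which is not
    a box but is exhausted by the cubes of half side \<open>n\<close>.\<close>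
  have all: "(\<integral>x. f x \<partial>M) = 0"
  proof -
    have "(\<lambda>n. \<integral>x. indicator (box (- (real n *\<^sub>R One)) (real n *\<^sub>R One)) x *\<^sub>R f x \<partial>M) \<longlonglongrightarrow> (\<integral>x. f x \<partial>M)"
    proof (rule integral_dominated_convergence[where w = "\<lambda>x. norm (f x)"])
      show "AE x in M. (\<lambda>n. indicator (box (- (real n *\<^sub>R One)) (real n *\<^sub>R One)) x *\<^sub>R f x) \<longlonglongrightarrow> f x"
      proof (rule AE_I2, rule tendsto_eventually)
        fix x :: point
        obtain N :: nat where N: "norm x < real N" using reals_Archimedean2 by blast
        have "x \<in> box (- (real n *\<^sub>R One)) (real n *\<^sub>R One)" if "n \<ge> N" for n
          unfolding mem_box
        proof
          fix e :: point assume e: "e \<in> Basis"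
          have "\<bar>x \<bullet> e\<bar> < real n"
            using N that Basis_le_norm[OF e, of x] by linarith
          then show "- (real n *\<^sub>R One) \<bullet> e < x \<bullet> e \<and> x \<bullet> e < (real n *\<^sub>R One) \<bullet> e"
            using e by (auto simp: abs_less_iff)
        qed
        then show "\<forall>\<^sub>F n in sequentially. indicator (box (- (real n *\<^sub>R One)) (real n *\<^sub>R One)) x *\<^sub>R f x = f x"
          by (intro eventually_sequentiallyI[of N]) simp
      qed
    qed (use f in \<open>auto simp: indicator_def\<close>)
    then show ?thesis using 0 by (simp add: set_lebesgue_integral_def LIMSEQ_const_iff)
  qed
  have borel: "A \<in> sigma_sets UNIV (range (\<lambda>(a, b). box a b)) \<longleftrightarrow> A \<in> sets borel" for A :: "point set"
    by (simp only: borel_eq_box Pow_UNIV subset_UNIV sets_measure_of)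
  have stable: "Int_stable (range (\<lambda>(a, b). box a b :: point set))"
  proof (rule Int_stableI)
    fix A B :: "point set"
    assume "A \<in> range (\<lambda>(a, b). box a b)" "B \<in> range (\<lambda>(a, b). box a b)"
    then obtain a b c d where "A = box a b" "B = box c d" by auto
    then show "A \<inter> B \<in> range (\<lambda>(a, b). box a b)"
      by (simp only: box_Int_box) (rule image_eqI[OF _ UNIV_I], rule case_prod_conv[symmetric])
  qed
  have subset_Pow: "range (\<lambda>(a, b). box a b :: point set) \<subseteq> Pow UNIV" by simp
  have sets0: "(\<integral>x\<in>A. f x \<partial>M) = 0" if "A \<in> sets M" for A
    using stable subset_Pow that[unfolded M borel[symmetric]]
  proof (induction rule: sigma_sets_induct_disjoint)
    case (compl A)
    then have A: "A \<in> sets borel" by (simp only: borel)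
    have "(\<integral>x\<in>A \<union> (UNIV - A). f x \<partial>M) = (\<integral>x\<in>A. f x \<partial>M) + (\<integral>x\<in>UNIV - A. f x \<partial>M)"
      using A by (intro set_integral_Un si) auto
    then show ?case using compl all by (simp add: set_lebesgue_integral_def)
  next
    case (union A)
    then have "A i \<in> sets borel" for i by (auto simp: borel[symmetric])
    then have "(\<integral>x\<in>(\<Union>i. A i). f x \<partial>M) = (\<Sum>i. \<integral>x\<in>A i. f x \<partial>M)"
      using union(1) by (intro lebesgue_integral_countable_add si) (auto simp: disjoint_family_on_def)
    then show ?case using union by simp
  qed (use 0 in \<open>auto simp: set_lebesgue_integral_def\<close>)
  show ?thesis by (rule sigma_finite_measure.density_zero[OF assms(1) f sets0])
qed

subsection \<open>Square integrable fields\<close>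

lemma vector3_eq_lambda: "(vector [a, b, c] :: 'a::zero ^ 3) = (\<chi> i. if i = 1 then a else if i = 2 then b else c)"
  by (simp add: vec_eq_iff forall_3)

lemma cdot_add_left: "cdot (u + v) w = cdot u w + cdot v w"
  by (simp add: cdot_def ring_distribs sum.distrib)

lemma cdot_scale_left: "cdot (c *s u) w = c * cdot u w"
  by (simp add: cdot_def sum_distrib_left mult.assoc)

lemma cdot_diff_left: "cdot (u - v) w = cdot u w - cdot v w"
  by (simp add: cdot_def ring_distribs sum_subtractf)

lemma cdot_scaleR_right: "cdot u (r *\<^sub>R w) = r *\<^sub>R cdot u w"
  by (simp add: cdot_def scaleR_sum_right)

lemma cdot_axis: "cdot u (axis i 1) = u $ i"
  by (simp add: cdot_def axis_def if_distrib[of "(*) _"] cong: if_cong)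

lemma cdot_vcnj_commute: "cdot v (vcnj u) = cnj (cdot u (vcnj v))"
  by (simp add: cdot_def vcnj_def mult.commute)

text \<open>The right-hand side is the real inner product of the six real coordinates; at
  \<open>u = v\<close> it is a squared norm, the source of all positivity below.\<close>

lemma Re_cdot_vcnj: "Re (cdot u (vcnj v)) = u \<bullet> v"
  by (simp add: cdot_def vcnj_def inner_vec_def inner_complex_def)

text \<open>The factor 3 counts components. It and the 6 in \<open>norm_ccross_le\<close> (three
  components with two products each) are crude, which suffices for integrability.\<close>

lemma norm_cdot_le: "norm (cdot u v) \<le> 3 * (norm u * norm v)"
proof -
  have "norm (cdot u v) \<le> (\<Sum>i\<in>(UNIV::3 set). norm u * norm v)"
    unfolding cdot_def by (rule sum_norm_le) (auto simp: norm_mult intro!: mult_mono Finite_Cartesian_Product.norm_nth_le)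
  then show ?thesis by simp
qed

lemma norm_vcnj [simp]: "norm (vcnj v) = norm v"
  by (simp add: norm_vec_def vcnj_def)

lemma norm_scale [simp]: "norm (c *s (v::cvec3)) = norm c * norm v"
  by (simp add: norm_vec_def vector_scalar_mult_def norm_mult L2_set_right_distrib)

lemma norm_vec3_le: "norm (v::cvec3) \<le> norm (v $ 1) + norm (v $ 2) + norm (v $ 3)"
proof -
  have "norm v \<le> (\<Sum>i\<in>UNIV. norm (v $ i))"
    unfolding norm_vec_def by (rule L2_set_le_sum) simp
  then show ?thesis by (simp add: sum_3)
qed

lemma norm_ccross_le: "norm (ccross u v) \<le> 6 * (norm u * norm v)"
proof -
  have *: "norm (u $ i * v $ j - u $ k * v $ l) \<le> 2 * (norm u * norm v)" for i j k l
    using norm_triangle_ineq4[of "u $ i * v $ j" "u $ k * v $ l"]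
      mult_mono[OF Finite_Cartesian_Product.norm_nth_le[of u i] Finite_Cartesian_Product.norm_nth_le[of v j]] mult_mono[OF Finite_Cartesian_Product.norm_nth_le[of u k] Finite_Cartesian_Product.norm_nth_le[of v l]]
    by (simp add: norm_mult)
  show ?thesis
    using norm_vec3_le[of "ccross u v"] *[of 2 3 3 2] *[of 3 1 1 3] *[of 1 2 2 1]
    by (simp add: ccross_def)
qed

lemma ccross_add_left: "ccross (u + v) w = ccross u w + ccross v w"
  by (simp add: ccross_def vec_eq_iff forall_3 algebra_simps)

lemma ccross_scale_left: "ccross (c *s u) w = c *s ccross u w"
  by (simp add: ccross_def vec_eq_iff forall_3 algebra_simps)

lemma measurable_cdot [measurable (raw)]:
  assumes "F \<in> borel_measurable M" "G \<in> borel_measurable M"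
  shows "(\<lambda>x. cdot (F x) (G x)) \<in> borel_measurable M"
  using assms by (rule borel_measurable_continuous_Pair) (auto simp: cdot_def intro!: continuous_intros)

lemma measurable_vcnj [measurable (raw)]:
  assumes "F \<in> borel_measurable M"
  shows "(\<lambda>x. vcnj (F x)) \<in> borel_measurable M"
  by (rule measurable_compose[OF assms], rule borel_measurable_continuous_onI)
     (auto simp: vcnj_def intro!: continuous_intros)

lemma measurable_scale [measurable (raw)]:
  assumes "F \<in> borel_measurable M"
  shows "(\<lambda>x. c *s (F x :: cvec3)) \<in> borel_measurable M"
  by (rule measurable_compose[OF assms], rule borel_measurable_continuous_onI)
     (auto simp: vector_scalar_mult_def intro!: continuous_intros)

lemma measurable_ccross [measurable (raw)]:
  assumes "F \<in> borel_measurable M" "G \<in> borel_measurable M"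
  shows "(\<lambda>x. ccross (F x) (G x)) \<in> borel_measurable M"
  using assms
proof (rule borel_measurable_continuous_Pair)
  show "continuous_on UNIV (\<lambda>x. ccross (fst x) (snd x))"
    unfolding ccross_def vector3_eq_lambda
  proof (rule continuous_on_vec_lambda)
    show "continuous_on UNIV (\<lambda>x::cvec3 \<times> cvec3. if i = 1 then fst x $ 2 * snd x $ 3 - fst x $ 3 * snd x $ 2
            else if i = 2 then fst x $ 3 * snd x $ 1 - fst x $ 1 * snd x $ 3
            else fst x $ 1 * snd x $ 2 - fst x $ 2 * snd x $ 1)" for i :: 3
      by (cases "i = 1"; cases "i = 2") (auto intro!: continuous_intros)
  qed
qed

lemma square_integrable_measurable [measurable_dest]: "square_integrable M F \<Longrightarrow> F \<in> borel_measurable M"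
  by (simp add: square_integrable_def)

lemma square_integrable_bound:
  assumes "square_integrable M F" and [measurable]: "G \<in> borel_measurable M"
    and "\<And>x. x \<in> space M \<Longrightarrow> norm (G x) \<le> C * norm (F x)"
  shows "square_integrable M G"
  unfolding square_integrable_def
proof
  show "integrable M (\<lambda>x. (norm (G x))\<^sup>2)"
  proof (rule Bochner_Integration.integrable_bound)
    show "integrable M (\<lambda>x. C\<^sup>2 * (norm (F x))\<^sup>2)"
      using assms(1) by (simp add: square_integrable_def)
    show "AE x in M. norm ((norm (G x))\<^sup>2) \<le> norm (C\<^sup>2 * (norm (F x))\<^sup>2)"
      using power_mono[OF assms(3) norm_ge_zero, of _ 2] by (auto simp: power_mult_distrib)
  qed simp
qed simp

lemma square_integrable_add:
  assumes "square_integrable M F" "square_integrable M G"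
  shows "square_integrable M (\<lambda>x. F x + G x)"
proof -
  note [measurable] = assms[THEN square_integrable_measurable]
  have "integrable M (\<lambda>x. (norm (F x + G x))\<^sup>2)"
  proof (rule Bochner_Integration.integrable_bound)
    show "integrable M (\<lambda>x. 2 * (norm (F x))\<^sup>2 + 2 * (norm (G x))\<^sup>2)"
      using assms by (simp add: square_integrable_def)
    have "(norm (a + b))\<^sup>2 \<le> 2 * (norm a)\<^sup>2 + 2 * (norm b)\<^sup>2" for a b :: cvec3
    proof -
      have "(norm (a + b))\<^sup>2 \<le> (norm a + norm b)\<^sup>2" by (intro power_mono norm_triangle_ineq) simp
      also have "\<dots> \<le> 2 * (norm a)\<^sup>2 + 2 * (norm b)\<^sup>2"
        using sum_squares_bound[of "norm a" "norm b"] by (simp add: power2_sum)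
      finally show ?thesis .
    qed
    then show "AE x in M. norm ((norm (F x + G x))\<^sup>2) \<le> norm (2 * (norm (F x))\<^sup>2 + 2 * (norm (G x))\<^sup>2)"
      by simp
  qed simp
  then show ?thesis by (simp add: square_integrable_def)
qed

lemma square_integrable_scale:
  assumes "square_integrable M F"
  shows "square_integrable M (\<lambda>x. c *s F x)"
  using assms(1)
proof (rule square_integrable_bound)
  show "(\<lambda>x. c *s F x) \<in> borel_measurable M"
    using square_integrable_measurable[OF assms] by measurable
  show "norm (c *s F x) \<le> norm c * norm (F x)" for x by simp
qed

lemma square_integrable_diff:
  assumes "square_integrable M F" "square_integrable M G"
  shows "square_integrable M (\<lambda>x. F x - G x)"
  using square_integrable_add[OF assms(1) square_integrable_scale[OF assms(2), of "-1"]]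
  by (simp add: vector_scalar_mult_def vec_eq_iff plus_vec_def minus_vec_def)

lemma square_integrable_subset:
  assumes "square_integrable (restrict_space M S) F" "T \<subseteq> S" "S \<in> sets M" "T \<in> sets M"
  shows "square_integrable (restrict_space M T) F"
proof -
  have eq: "restrict_space M T = restrict_space (restrict_space M S) T"
    using assms by (simp add: restrict_restrict_space Int_absorb1)
  have T: "T \<inter> space (restrict_space M S) \<in> sets (restrict_space M S)"
    using assms by (auto simp: sets_restrict_space space_restrict_space intro!: image_eqI[of _ _ T] dest: sets.sets_into_space)
  have "integrable (restrict_space M S) (\<lambda>x. (norm (F x))\<^sup>2)"
    using assms(1) by (simp add: square_integrable_def)
  from integrable_mult_indicator[OF T this]
  have "integrable (restrict_space M S) (\<lambda>x. indicator T x *\<^sub>R (norm (F x))\<^sup>2)"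
    by (rule Bochner_Integration.integrable_cong[THEN iffD1, OF refl, rotated]) (simp add: indicator_def)
  then have "integrable (restrict_space M T) (\<lambda>x. (norm (F x))\<^sup>2)"
    unfolding eq by (rule integrable_restrict_space[OF T, THEN iffD2])
  moreover have "F \<in> borel_measurable (restrict_space M T)"
    unfolding eq by (rule measurable_restrict_space1) (use assms(1) in \<open>simp add: square_integrable_def\<close>)
  ultimately show ?thesis by (simp add: square_integrable_def)
qed

lemma integrable_cdot:
  assumes "square_integrable M F" "square_integrable M G"
  shows "integrable M (\<lambda>x. cdot (F x) (G x))"
proof (rule Bochner_Integration.integrable_bound)
  note [measurable] = assms[THEN square_integrable_measurable]
  show "integrable M (\<lambda>x. 2 * (norm (F x))\<^sup>2 + 2 * (norm (G x))\<^sup>2)"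
    using assms by (simp add: square_integrable_def)
  show "(\<lambda>x. cdot (F x) (G x)) \<in> borel_measurable M" by measurable
  \<comment> \<open>The constant 2 absorbs the 3 of \<open>norm_cdot_le\<close>: 4xy is at most 2x^2
    + 2y^2, and xy is nonnegative for norms.\<close>
  have "norm (cdot a b) \<le> 2 * (norm a)\<^sup>2 + 2 * (norm b)\<^sup>2" for a b
  proof -
    have "3 * (norm a * norm b) \<le> 2 * (norm a)\<^sup>2 + 2 * (norm b)\<^sup>2"
      using sum_squares_bound[of "norm a" "norm b"] mult_nonneg_nonneg[OF norm_ge_zero[of a] norm_ge_zero[of b]] by linarith
    then show ?thesis using norm_cdot_le[of a b] by linarith
  qed
  then show "AE x in M. norm (cdot (F x) (G x)) \<le> norm (2 * (norm (F x))\<^sup>2 + 2 * (norm (G x))\<^sup>2)"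
    by simp
qed

lemma square_integrable_vcnj: "square_integrable M F \<Longrightarrow> square_integrable M (\<lambda>x. vcnj (F x))"
  unfolding square_integrable_def by auto

text \<open>The identity is assumed measurable instead of fixing the sigma-algebra, so that both
  Lebesgue sets on an element and Borel sets on its boundary are covered.\<close>

lemma square_integrable_continuous:
  assumes M: "finite_measure M" "(\<lambda>x. x) \<in> measurable M borel" "bounded (space M)"
    and G: "continuous_on UNIV G"
  shows "square_integrable M G"
proof -
  have [measurable]: "G \<in> borel_measurable M"
    using measurable_compose[OF M(2) borel_measurable_continuous_onI[OF G]] by simp
  have "compact (G ` closure (space M))"
    using M(3) G by (intro compact_continuous_image) (auto intro: continuous_on_subset simp: compact_closure)
  then obtain B where B: "\<And>x. x \<in> closure (space M) \<Longrightarrow> norm (G x) \<le> B"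
    using compact_imp_bounded bounded_iff by (metis imageI)
  have "integrable M (\<lambda>x. (norm (G x))\<^sup>2)"
    using B closure_subset[of "space M"]
    by (intro finite_measure.integrable_const_bound[OF M(1), where B = "B\<^sup>2"])
       (auto intro!: power_mono AE_I2)
  then show ?thesis by (simp add: square_integrable_def)
qed

lemma continuous_on_smooth_field: "smooth_field v \<Longrightarrow> continuous_on UNIV v"
  unfolding smooth_field_def by (metis Ck.simps(1))

lemma continuous_on_pderiv3: "smooth_field v \<Longrightarrow> continuous_on UNIV (pderiv3 j v)"
proof -
  assume "smooth_field v"
  then have "Ck 1 v" by (simp add: smooth_field_def)
  then obtain v' where v': "\<And>x. (v has_derivative v' x) (at x)" "\<And>h. continuous_on UNIV (\<lambda>x. v' x h)"
    by auto
  have "pderiv3 j v = (\<lambda>x. v' x (axis j 1))"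
    unfolding pderiv3_def by (rule ext) (metis frechet_derivative_at v'(1))
  with v'(2) show ?thesis by simp
qed

lemma continuous_on_classical_curl:
  assumes "smooth_field v"
  shows "continuous_on UNIV (classical_curl v)"
proof -
  note [continuous_intros] = continuous_on_pderiv3[OF assms]
  have "continuous_on UNIV (\<lambda>x. classical_curl v x $ i)" for i
    by (cases "i = 1"; cases "i = 2")
       (auto simp: classical_curl_def vector3_eq_lambda intro!: continuous_intros)
  then have "continuous_on UNIV (\<lambda>x. \<chi> i. classical_curl v x $ i)"
    by (rule continuous_on_vec_lambda)
  then show ?thesis by simp
qed

lemma finite_measure_lebesgue_on:
  assumes "open D" "bounded D"
  shows "finite_measure (lebesgue_on D)"
proof -
  have "D \<in> sets lborel" using assms by simp
  then have "emeasure lebesgue D < \<infinity>"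
    using emeasure_bounded_finite[OF assms(2)] by simp
  then show ?thesis
    using \<open>D \<in> sets lborel\<close>
    by (intro finite_measureI) (simp add: emeasure_restrict_space space_restrict_space less_top)
qed

lemma measurable_id_lebesgue_on: "(\<lambda>x. x) \<in> borel_measurable (lebesgue_on D)"
  by (intro measurable_restrict_space1 measurable_completion) simp

lemma square_integrable_lebesgue_on_continuous:
  assumes "open D" "bounded D" "continuous_on UNIV G"
  shows "square_integrable (lebesgue_on D) G"
  using assms
  by (intro square_integrable_continuous finite_measure_lebesgue_on measurable_id_lebesgue_on)
     (auto simp: space_restrict_space)

lemma AE_zero_if_test_fields:
  assumes C: "square_integrable (lebesgue_on D) C" and D: "open D" "bounded D"
    and 0: "\<And>f. test_field D f \<Longrightarrow> (\<integral>x. cdot (C x) (f x) \<partial>lebesgue_on D) = 0"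
  shows "AE x in lebesgue_on D. C x = 0"
proof -
  have [measurable]: "D \<in> sets borel" using D by simp
  have Dl: "D \<inter> space lebesgue \<in> sets lebesgue" by simp
  have "AE x in lborel. x \<in> D \<longrightarrow> C x $ i = 0" for i
  proof -
    have Ci: "integrable (lebesgue_on D) (\<lambda>x. C x $ i)"
      using integrable_cdot[OF C square_integrable_lebesgue_on_continuous[OF D, of "\<lambda>_. axis i 1"]]
      by (simp add: cdot_axis)
    then have int: "integrable lebesgue (\<lambda>x. indicator D x *\<^sub>R C x $ i)"
      by (rule integrable_restrict_space[OF Dl, THEN iffD1])
    \<comment> \<open>The component, extended by 0 outside \<open>D\<close>, is replaced by a Borel
      function \<open>g\<close> equal to it almost everywhere. Real and imaginary parts are treated
      separately because the representative is supplied for real functions.\<close>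
    from int have Dmeas: "(\<lambda>x. indicator D x *\<^sub>R C x $ i) \<in> borel_measurable lebesgue"
      by (rule borel_measurable_integrable)
    from completion_ex_borel_measurable_real[OF measurable_compose[OF Dmeas borel_measurable_Re]]
    obtain gr where gr: "gr \<in> borel_measurable lborel" "AE x in lborel. Re (indicator D x *\<^sub>R C x $ i) = gr x"
      by auto
    from completion_ex_borel_measurable_real[OF measurable_compose[OF Dmeas borel_measurable_Im]]
    obtain gi where gi: "gi \<in> borel_measurable lborel" "AE x in lborel. Im (indicator D x *\<^sub>R C x $ i) = gi x"
      by auto
    define g where "g = (\<lambda>x. complex_of_real (gr x) + \<i> * complex_of_real (gi x))"
    have [measurable]: "g \<in> borel_measurable lborel"
      using gr(1) gi(1) by (simp add: g_def)
    have g_eq: "AE x in lborel. indicator D x *\<^sub>R C x $ i = g x"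
      using gr(2) gi(2) by eventually_elim (simp add: g_def complex_eq_iff)
    then have g_eq': "AE x in lebesgue. indicator D x *\<^sub>R C x $ i = g x"
      by (simp add: AE_completion_iff)
    have "g \<in> borel_measurable lebesgue"
      by (intro measurable_completion) simp
    then have "integrable lebesgue g"
      by (rule integrable_cong_AE_imp[OF int _ g_eq'])
    then have g_int: "integrable lborel g"
      by (simp add: integrable_completion)
    have box0: "(\<integral>x\<in>box a b. g x \<partial>lborel) = 0" if "cbox a b \<subseteq> D" for a b
    proof (rule box_integral_zero_if_bump)
      fix n
      have "(\<integral>x. bump a b n x *\<^sub>R g x \<partial>lborel) = (\<integral>x. bump a b n x *\<^sub>R g x \<partial>lebesgue)"
        by (rule integral_completion[symmetric]) simp
      also have "\<dots> = (\<integral>x. indicator D x *\<^sub>R (bump a b n x *\<^sub>R C x $ i) \<partial>lebesgue)"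
      proof (rule integral_cong_AE)
        show "(\<lambda>x. bump a b n x *\<^sub>R g x) \<in> borel_measurable lebesgue"
          by (intro measurable_completion) simp
        have "(\<lambda>x. bump a b n x *\<^sub>R (indicator D x *\<^sub>R C x $ i)) \<in> borel_measurable lebesgue"
          by (rule borel_measurable_scaleR[OF measurable_completion Dmeas]) simp
        then show "(\<lambda>x. indicator D x *\<^sub>R (bump a b n x *\<^sub>R C x $ i)) \<in> borel_measurable lebesgue"
          by (simp add: mult.commute)
        show "AE x in lebesgue. bump a b n x *\<^sub>R g x = indicator D x *\<^sub>R (bump a b n x *\<^sub>R C x $ i)"
          using g_eq' by eventually_elim (metis scaleR_left_commute)
      qed
      also have "\<dots> = (\<integral>x. cdot (C x) (bump a b n x *\<^sub>R axis i 1) \<partial>lebesgue_on D)"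
        by (simp add: integral_restrict_space[OF Dl] cdot_scaleR_right cdot_axis)
      also have "\<dots> = 0"
        by (rule 0[OF test_field_bump[OF that]])
      finally show "(\<integral>x. bump a b n x *\<^sub>R g x \<partial>lborel) = 0" .
    qed (use g_int in auto)
    \<comment> \<open>The Borel lemma needs vanishing integrals over all boxes. Cutting
      \<open>g\<close> off outside \<open>box a b\<close> replaces any box by its intersection with
      \<open>box a b\<close>, again a box.\<close>
    have box_ae: "AE x in lborel. indicator (box a b) x *\<^sub>R g x = 0" if ab: "cbox a b \<subseteq> D" for a b
    proof (rule AE_zero_if_box_integrals_zero)
      fix c d :: point
      obtain a' b' where ab': "box a b \<inter> box c d = box a' b'" by (simp only: box_Int_box)
      have "(\<integral>x\<in>box c d. indicator (box a b) x *\<^sub>R g x \<partial>lborel) = (\<integral>x\<in>box a' b'. g x \<partial>lborel)"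
        unfolding set_lebesgue_integral_def ab'[symmetric]
        by (intro Bochner_Integration.integral_cong) (auto simp: indicator_def)
      also have "\<dots> = 0"
      \<comment> \<open>For a nonempty open box the closed box is its closure and stays inside
        \<open>cbox a b\<close>. An empty open box says nothing about \<open>cbox a' b'\<close>, but
        then the integral is trivially 0.\<close>
      proof (cases "box a' b' = {}")
        case False
        then have "cbox a' b' \<subseteq> closure (box a b)"
          by (metis Int_lower1 ab' closure_box closure_mono)
        also have "\<dots> \<subseteq> cbox a b" by (rule closure_minimal[OF box_subset_cbox closed_cbox])
        finally show ?thesis using ab by (intro box0) simp
      qed (simp add: set_lebesgue_integral_def)
      finally show "(\<integral>x\<in>box c d. indicator (box a b) x *\<^sub>R g x \<partial>lborel) = 0" .
    qed (use g_int in \<open>auto intro: sigma_finite_lborel integrable_mult_indicator\<close>)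
    have ae: "AE x in lborel. x \<in> box a b \<longrightarrow> g x = 0" if "cbox a b \<subseteq> D" for a b
      using box_ae[OF that] by eventually_elim (simp add: indicator_def split: if_splits)
    \<comment> \<open>The boxes with closed box in \<open>D\<close> cover \<open>D\<close>, but
      there are uncountably many; Lindelof extracts a countable subfamily, whose exceptional null
      sets can be united.\<close>
    obtain \<F> where \<F>: "\<F> \<subseteq> {box a b |a b. cbox a b \<subseteq> D}" "countable \<F>" "\<Union>\<F> = \<Union>{box a b |a b. cbox a b \<subseteq> D}"
      by (rule Lindelof[of "{box a b |a b. cbox a b \<subseteq> D}"]) (auto simp: open_box)
    have cover: "D \<subseteq> \<Union>\<F>"
    proof
      fix x assume "x \<in> D"
      then obtain a b where "cbox a b \<subseteq> D" "x \<in> box a b"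
        using open_contains_cbox[OF D(1)] by metis
      then show "x \<in> \<Union>\<F>" unfolding \<F>(3) by blast
    qed
    have "AE x in lborel. \<forall>B\<in>\<F>. x \<in> B \<longrightarrow> g x = 0"
      unfolding AE_ball_countable[OF \<F>(2)] using \<F>(1) ae by blast
    then show ?thesis
      using g_eq by eventually_elim (use cover in auto)
  qed
  then have "AE x in lborel. \<forall>i\<in>UNIV. x \<in> D \<longrightarrow> C x $ i = 0"
    by (subst AE_ball_countable) auto
  then have "AE x in lebesgue. x \<in> D \<longrightarrow> C x = 0"
    unfolding AE_completion_iff by eventually_elim (auto simp: vec_eq_iff)
  then show ?thesis by (simp add: AE_restrict_space_iff)
qed

subsection \<open>Linearity of curl and traces\<close>

lemma has_curl_lincomb:
  assumes D: "open D" "bounded D" and F: "has_curl D F C" and G: "has_curl D G C'"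
  shows "has_curl D (\<lambda>x. c *s F x + G x) (\<lambda>x. c *s C x + C' x)"
  unfolding has_curl_def
proof (intro conjI allI impI)
  show "square_integrable (lebesgue_on D) (\<lambda>x. c *s F x + G x)"
    "square_integrable (lebesgue_on D) (\<lambda>x. c *s C x + C' x)"
    using F G by (auto simp: has_curl_def intro!: square_integrable_add square_integrable_scale)
next
  fix f assume f: "test_field D f"
  then have "smooth_field f" by (simp add: test_field_def)
  then have *: "square_integrable (lebesgue_on D) f" "square_integrable (lebesgue_on D) (classical_curl f)"
    using D by (auto intro!: square_integrable_lebesgue_on_continuous continuous_on_smooth_field continuous_on_classical_curl)
  have "integrable (lebesgue_on D) (\<lambda>x. cdot (C x) (f x))" "integrable (lebesgue_on D) (\<lambda>x. cdot (C' x) (f x))"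
    "integrable (lebesgue_on D) (\<lambda>x. cdot (F x) (classical_curl f x))"
    "integrable (lebesgue_on D) (\<lambda>x. cdot (G x) (classical_curl f x))"
    using F G * by (auto simp: has_curl_def intro!: integrable_cdot)
  then show "(\<integral>x. cdot (c *s C x + C' x) (f x) \<partial>lebesgue_on D)
      = (\<integral>x. cdot (c *s F x + G x) (classical_curl f x) \<partial>lebesgue_on D)"
    using F G f by (simp add: has_curl_def cdot_add_left cdot_scale_left)
qed

lemma has_curl_AE_unique:
  assumes D: "open D" "bounded D" and C: "has_curl D F C" "has_curl D F C'"
  shows "AE x in lebesgue_on D. C x = C' x"
proof -
  have sq: "square_integrable (lebesgue_on D) C" "square_integrable (lebesgue_on D) C'"
    using C by (auto simp: has_curl_def)
  have "AE x in lebesgue_on D. C x - C' x = 0"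
  proof (rule AE_zero_if_test_fields[OF square_integrable_diff[OF sq] D])
    fix f assume f: "test_field D f"
    then have "square_integrable (lebesgue_on D) f"
      using D by (intro square_integrable_lebesgue_on_continuous continuous_on_smooth_field) (auto simp: test_field_def)
    then have "integrable (lebesgue_on D) (\<lambda>x. cdot (C x) (f x))" "integrable (lebesgue_on D) (\<lambda>x. cdot (C' x) (f x))"
      using sq by (auto intro: integrable_cdot)
    then show "(\<integral>x. cdot (C x - C' x) (f x) \<partial>lebesgue_on D) = 0"
      using C f by (simp add: has_curl_def cdot_diff_left)
  qed
  then show ?thesis by eventually_elim simp
qed

text \<open>Needed because the chosen \<open>curl\<close> of a combination agrees with the
  combination of the chosen curls only almost everywhere, and the Trefftz equation takes a further
  curl of it.\<close>

lemma has_curl_cong_AE: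
  assumes D: "open D" "bounded D" and F: "has_curl D F C"
    and F': "square_integrable (lebesgue_on D) F'" "AE x in lebesgue_on D. F x = F' x"
    and C': "square_integrable (lebesgue_on D) C'" "AE x in lebesgue_on D. C x = C' x"
  shows "has_curl D F' C'"
  unfolding has_curl_def
proof (intro conjI allI impI F' C')
  fix f assume f: "test_field D f"
  then have "smooth_field f" by (simp add: test_field_def)
  then have "square_integrable (lebesgue_on D) f" "square_integrable (lebesgue_on D) (classical_curl f)"
    using D by (auto intro!: square_integrable_lebesgue_on_continuous continuous_on_smooth_field continuous_on_classical_curl)
  note [measurable] = this[THEN square_integrable_measurable]
    F'(1)[THEN square_integrable_measurable] C'(1)[THEN square_integrable_measurable]
  have [measurable]: "F \<in> borel_measurable (lebesgue_on D)" "C \<in> borel_measurable (lebesgue_on D)"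
    using F by (auto simp: has_curl_def square_integrable_def)
  have "(\<integral>x. cdot (C' x) (f x) \<partial>lebesgue_on D) = (\<integral>x. cdot (C x) (f x) \<partial>lebesgue_on D)"
    by (rule integral_cong_AE) (measurable, use C'(2) in \<open>eventually_elim, simp\<close>)
  also have "\<dots> = (\<integral>x. cdot (F x) (classical_curl f x) \<partial>lebesgue_on D)"
    using F f by (simp add: has_curl_def)
  also have "\<dots> = (\<integral>x. cdot (F' x) (classical_curl f x) \<partial>lebesgue_on D)"
    by (rule integral_cong_AE) (measurable, use F'(2) in \<open>eventually_elim, simp\<close>)
  finally show "(\<integral>x. cdot (C' x) (f x) \<partial>lebesgue_on D) = (\<integral>x. cdot (F' x) (classical_curl f x) \<partial>lebesgue_on D)" .
qed

lemma has_curl_curl: "F \<in> Hcurl D \<Longrightarrow> has_curl D F (curl D F)"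
  unfolding Hcurl_def curl_def using someI_ex[of "has_curl D F"] by simp

lemma Hcurl_lincomb:
  "open D \<Longrightarrow> bounded D \<Longrightarrow> F \<in> Hcurl D \<Longrightarrow> G \<in> Hcurl D \<Longrightarrow> (\<lambda>x. c *s F x + G x) \<in> Hcurl D"
  unfolding Hcurl_def using has_curl_lincomb by blast

lemma curl_lincomb:
  assumes D: "open D" "bounded D" and FG: "F \<in> Hcurl D" "G \<in> Hcurl D"
  shows "AE x in lebesgue_on D. curl D (\<lambda>x. c *s F x + G x) x = c *s curl D F x + curl D G x"
  by (rule has_curl_AE_unique[OF D has_curl_curl[OF Hcurl_lincomb[OF D FG]]
        has_curl_lincomb[OF D has_curl_curl[OF FG(1)] has_curl_curl[OF FG(2)]]])

lemma curl_cong_AE: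
  assumes D: "open D" "bounded D" and F: "F \<in> Hcurl D"
    and F': "square_integrable (lebesgue_on D) F'" "AE x in lebesgue_on D. F x = F' x"
  shows "F' \<in> Hcurl D" and "AE x in lebesgue_on D. curl D F' x = curl D F x"
proof -
  have C: "has_curl D F (curl D F)" by (rule has_curl_curl[OF F])
  then have "square_integrable (lebesgue_on D) (curl D F)" by (simp add: has_curl_def)
  then have *: "has_curl D F' (curl D F)"
    by (rule has_curl_cong_AE[OF D C F']) simp
  then show F'H: "F' \<in> Hcurl D" by (auto simp: Hcurl_def)
  show "AE x in lebesgue_on D. curl D F' x = curl D F x"
    by (rule has_curl_AE_unique[OF D has_curl_curl[OF F'H] *])
qed

section \<open>Traces on the boundary of an element\<close>

abbreviation bmeasure :: "point set \<Rightarrow> point measure" where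
  "bmeasure D \<equiv> restrict_space area (frontier D)"

lemma square_integrable_bmeasure_continuous:
  assumes "bounded D" "finite_measure (bmeasure D)" "continuous_on UNIV G"
  shows "square_integrable (bmeasure D) G"
  using assms(2)
proof (rule square_integrable_continuous[OF _ _ _ assms(3)])
  show "(\<lambda>x. x) \<in> borel_measurable (bmeasure D)"
    by (rule measurable_restrict_space1) simp
  show "bounded (space (bmeasure D))"
    using compact_imp_bounded[OF compact_frontier_bounded[OF assms(1)]] by (simp add: space_restrict_space)
qed

lemma AE_zero_if_smooth_fields:
  assumes D: "bounded D" and fin: "finite_measure (bmeasure D)"
    and T: "square_integrable (bmeasure D) T"
    and 0: "\<And>v. smooth_field v \<Longrightarrow> (\<integral>x. cdot (T x) (v x) \<partial>bmeasure D) = 0"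
  shows "AE x in bmeasure D. T x = 0"
proof -
  have S: "frontier D \<inter> space area \<in> sets area" by (simp add: borel_closed)
  have [measurable]: "(\<lambda>x. x) \<in> borel_measurable (bmeasure D)"
    by (rule measurable_restrict_space1) simp
  \<comment> \<open>The image under the inclusion carries the surface measure to the Borel sets of
    the whole space, as the box lemmas require. Accordingly \<open>f\<close> below extends the
    component by 0 off the boundary.\<close>
  define M where "M = distr (bmeasure D) borel (\<lambda>x. x)"
  have sets_M: "sets M = sets borel" by (simp add: M_def)
  have fin_M: "finite_measure M"
    unfolding M_def by (rule finite_measure.finite_measure_distr[OF fin]) simp
  have "AE x in bmeasure D. T x $ i = 0" for i
  proof -
    define f where "f x = indicator (frontier D) x *\<^sub>R T x $ i" for x
    have Ti: "integrable (bmeasure D) (\<lambda>x. T x $ i)"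
      using integrable_cdot[OF T square_integrable_bmeasure_continuous[OF D fin, of "\<lambda>_. axis i 1"]]
      by (simp add: cdot_axis)
    have eq: "f x = T x $ i" if "x \<in> space (bmeasure D)" for x
      using that by (simp add: f_def space_restrict_space)
    have "f \<in> borel_measurable area"
      unfolding f_def
      by (rule borel_measurable_restrict_space_iff[OF S, THEN iffD1]) (rule borel_measurable_integrable[OF Ti])
    then have f[measurable]: "f \<in> borel_measurable borel" by simp
    have "integrable (bmeasure D) f"
      using Ti eq by (subst Bochner_Integration.integrable_cong[OF refl]) auto
    then have f_int: "integrable M f"
      unfolding M_def by (subst integrable_distr_eq) auto
    have "AE x in M. f x = 0"
    proof (rule AE_zero_if_box_integrals_zero[OF _ sets_M f_int])
      show "sigma_finite_measure M"
        using fin_M by (simp add: finite_measure_def)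
      fix a b :: point
      show "(\<integral>x\<in>box a b. f x \<partial>M) = 0"
      proof (rule box_integral_zero_if_bump[OF sets_M f_int])
        fix n
        have "(\<integral>x. bump a b n x *\<^sub>R f x \<partial>M) = (\<integral>x. bump a b n x *\<^sub>R f x \<partial>bmeasure D)"
          unfolding M_def by (rule integral_distr) auto
        also have "\<dots> = (\<integral>x. cdot (T x) (bump a b n x *\<^sub>R axis i 1) \<partial>bmeasure D)"
          by (rule Bochner_Integration.integral_cong) (simp_all add: eq cdot_scaleR_right cdot_axis)
        also have "\<dots> = 0" by (rule 0[OF smooth_field_bump])
        finally show "(\<integral>x. bump a b n x *\<^sub>R f x \<partial>M) = 0" .
      qed
    qed
    then have "AE x in bmeasure D. f x = 0"
      unfolding M_def by (subst (asm) AE_distr_iff) auto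
    then show ?thesis
      using eq by (auto elim!: AE_mp)
  qed
  then have "AE x in bmeasure D. \<forall>i\<in>UNIV. T x $ i = 0"
    by (subst AE_ball_countable) auto
  then show ?thesis by eventually_elim (simp add: vec_eq_iff)
qed

lemma has_trace_AE_unique:
  assumes D: "bounded D" and fin: "finite_measure (bmeasure D)"
    and T: "has_trace D F T" "has_trace D F T'"
  shows "AE x in bmeasure D. T x = T' x"
proof -
  have sq: "square_integrable (bmeasure D) T" "square_integrable (bmeasure D) T'"
    using T by (auto simp: has_trace_def)
  have "AE x in bmeasure D. T x - T' x = 0"
  proof (rule AE_zero_if_smooth_fields[OF D fin square_integrable_diff[OF sq]])
    fix v assume v: "smooth_field v"
    then have "square_integrable (bmeasure D) v"
      by (intro square_integrable_bmeasure_continuous D fin continuous_on_smooth_field)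
    then have "integrable (bmeasure D) (\<lambda>x. cdot (T x) (v x))" "integrable (bmeasure D) (\<lambda>x. cdot (T' x) (v x))"
      using sq by (auto intro: integrable_cdot)
    then show "(\<integral>x. cdot (T x - T' x) (v x) \<partial>bmeasure D) = 0"
      using T v by (simp add: has_trace_def cdot_diff_left)
  qed
  then show ?thesis by eventually_elim simp
qed

text \<open>\<open>H\<close> is required to equal the combination only almost everywhere, since it
  is later instantiated with the chosen \<open>curl\<close> or the flux of a combination.\<close>

lemma has_trace_lincomb:
  assumes D: "open D" "bounded D" and fin: "finite_measure (bmeasure D)"
    and FG: "F \<in> Hcurl D" "G \<in> Hcurl D" and T: "has_trace D F T" "has_trace D G T'"
    and H: "square_integrable (lebesgue_on D) H" "AE x in lebesgue_on D. c *s F x + G x = H x"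
  shows "has_trace D H (\<lambda>x. c *s T x + T' x)"
  unfolding has_trace_def
proof (intro conjI allI impI)
  have sq: "square_integrable (bmeasure D) T" "square_integrable (bmeasure D) T'"
    using T by (auto simp: has_trace_def)
  then show "square_integrable (bmeasure D) (\<lambda>x. c *s T x + T' x)"
    by (intro square_integrable_add square_integrable_scale)
  have "AE x in bmeasure D. cdot (T x) (normal D x) = 0" "AE x in bmeasure D. cdot (T' x) (normal D x) = 0"
    using T by (auto simp: has_trace_def)
  then show "AE x in bmeasure D. cdot (c *s T x + T' x) (normal D x) = 0"
    by eventually_elim (simp add: cdot_add_left cdot_scale_left)
  fix v assume v: "smooth_field v"
  let ?L = "lebesgue_on D"
  have v': "square_integrable ?L v" "square_integrable ?L (classical_curl v)"
    using D v by (auto intro!: square_integrable_lebesgue_on_continuous continuous_on_smooth_field continuous_on_classical_curl)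
  have v'': "square_integrable (bmeasure D) v"
    using v by (intro square_integrable_bmeasure_continuous D fin continuous_on_smooth_field)
  have FG_sq: "square_integrable ?L F" "square_integrable ?L G" "square_integrable ?L (curl D F)" "square_integrable ?L (curl D G)"
    using FG[THEN has_curl_curl] by (auto simp: has_curl_def)
  note FGH = Hcurl_lincomb[OF D FG, of c]
  have H_sq: "square_integrable ?L (curl D H)"
    using has_curl_curl[OF curl_cong_AE(1)[OF D FGH H]] by (simp add: has_curl_def)
  have H_eq: "AE x in ?L. curl D H x = c *s curl D F x + curl D G x"
    using curl_cong_AE(2)[OF D FGH H] curl_lincomb[OF D FG, of c] by eventually_elim simp
  note [measurable] = v'[THEN square_integrable_measurable] FG_sq[THEN square_integrable_measurable]
    H_sq[THEN square_integrable_measurable] H(1)[THEN square_integrable_measurable]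
  have "(\<integral>x. cdot (H x) (classical_curl v x) - cdot (curl D H x) (v x) \<partial>?L)
      = (\<integral>x. c * (cdot (F x) (classical_curl v x) - cdot (curl D F x) (v x))
            + (cdot (G x) (classical_curl v x) - cdot (curl D G x) (v x)) \<partial>?L)"
  proof (rule integral_cong_AE)
    show "AE x in ?L. cdot (H x) (classical_curl v x) - cdot (curl D H x) (v x)
        = c * (cdot (F x) (classical_curl v x) - cdot (curl D F x) (v x))
            + (cdot (G x) (classical_curl v x) - cdot (curl D G x) (v x))"
      using H(2) H_eq
    proof eventually_elim
      case (elim x)
      then show ?case
        by (simp only: elim(1)[symmetric] elim(2) cdot_add_left cdot_scale_left) (simp add: algebra_simps)
    qed
  qed measurable
  also have "\<dots> = c * (\<integral>x. cdot (F x) (classical_curl v x) - cdot (curl D F x) (v x) \<partial>?L)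
      + (\<integral>x. cdot (G x) (classical_curl v x) - cdot (curl D G x) (v x) \<partial>?L)"
    using FG_sq v' by (subst Bochner_Integration.integral_add) (auto intro!: integrable_cdot Bochner_Integration.integrable_diff integrable_mult_right)
  also have "\<dots> = c * (\<integral>x. cdot (T x) (v x) \<partial>bmeasure D) + (\<integral>x. cdot (T' x) (v x) \<partial>bmeasure D)"
    using T v by (simp add: has_trace_def)
  also have "\<dots> = (\<integral>x. cdot (c *s T x + T' x) (v x) \<partial>bmeasure D)"
    using sq v'' by (simp add: cdot_add_left cdot_scale_left integrable_cdot)
  finally show "(\<integral>x. cdot (H x) (classical_curl v x) - cdot (curl D H x) (v x) \<partial>?L)
      = (\<integral>x. cdot (c *s T x + T' x) (v x) \<partial>bmeasure D)" .
qed

lemma has_trace_trace: "has_trace D F T \<Longrightarrow> has_trace D F (trace D F)"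
  unfolding trace_def by (rule someI[of "has_trace D F"])

lemma trace_lincomb:
  assumes D: "open D" "bounded D" and fin: "finite_measure (bmeasure D)"
    and FG: "F \<in> Hcurl D" "G \<in> Hcurl D" and T: "\<exists>T. has_trace D F T" "\<exists>T. has_trace D G T"
    and H: "square_integrable (lebesgue_on D) H" "AE x in lebesgue_on D. c *s F x + G x = H x"
  shows "\<exists>T. has_trace D H T"
    and "AE x in bmeasure D. trace D H x = c *s trace D F x + trace D G x"
proof -
  have *: "has_trace D H (\<lambda>x. c *s trace D F x + trace D G x)"
    using T by (intro has_trace_lincomb[OF D fin FG _ _ H]) (auto intro: has_trace_trace)
  then show "\<exists>T. has_trace D H T" by blast
  show "AE x in bmeasure D. trace D H x = c *s trace D F x + trace D G x"
    by (rule has_trace_AE_unique[OF D(2) fin has_trace_trace[OF *] *])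
qed

subsection \<open>The area of polyhedral boundaries\<close>

text \<open>The orthogonal projection in closed form, optimal by Cauchy-Schwarz. It makes
  \<open>closest_point\<close> continuous and the cylinders in \<open>plane_area\<close>
  explicit.\<close>

lemma closest_point_hyperplane:
  assumes "a \<noteq> 0"
  shows "closest_point {x::'a::euclidean_space. a \<bullet> x = b} x = x - ((a \<bullet> x - b) / (a \<bullet> a)) *\<^sub>R a"
proof (rule closest_point_unique[symmetric])
  show "x - ((a \<bullet> x - b) / (a \<bullet> a)) *\<^sub>R a \<in> {x. a \<bullet> x = b}"
    using assms by (simp add: inner_diff_right)
  show "\<forall>z\<in>{x. a \<bullet> x = b}. dist x (x - ((a \<bullet> x - b) / (a \<bullet> a)) *\<^sub>R a) \<le> dist x z"
  proof
    fix z assume "z \<in> {x. a \<bullet> x = b}"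
    then have "\<bar>a \<bullet> x - b\<bar> \<le> norm a * norm (x - z)"
      using Cauchy_Schwarz_ineq2[of a "x - z"] by (simp add: inner_diff_right)
    then show "dist x (x - ((a \<bullet> x - b) / (a \<bullet> a)) *\<^sub>R a) \<le> dist x z"
      using assms by (simp add: dist_norm abs_mult power2_norm_eq_inner[symmetric] power2_eq_square field_simps)
  qed
qed (auto simp: convex_hyperplane closed_hyperplane)

lemma planesE:
  assumes "P \<in> planes"
  obtains a b where "a \<noteq> 0" "P = {x. a \<bullet> x = b}"
  using assms aff_dim_eq_hyperplane[of P] hull_same[of affine P] by (auto simp: planes_def)

lemma hyperplane_in_planes: "a \<noteq> 0 \<Longrightarrow> {x. a \<bullet> x = b} \<in> planes"
  by (simp add: planes_def affine_hyperplane aff_dim_hyperplane)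

lemma emeasure_plane_area:
  assumes "P \<in> planes" and A: "A \<in> sets borel"
  shows "emeasure (plane_area P) A = emeasure lborel ({x. infdist x P \<le> 1 / 2} \<inter> closest_point P -` A)"
proof -
  obtain a b where ab: "a \<noteq> 0" "P = {x. a \<bullet> x = b}" using planesE[OF assms(1)] .
  have "closed {x. infdist x P \<le> 1 / 2}"
    by (intro closed_Collect_le continuous_intros)
  then have slab: "{x. infdist x P \<le> 1 / 2} \<in> sets borel" by (rule borel_closed)
  have cp: "closest_point P \<in> borel_measurable borel"
    unfolding ab(2) closest_point_hyperplane[OF ab(1)]
    by (rule borel_measurable_continuous_onI) (intro continuous_intros, use ab(1) in auto)
  then have "closest_point P \<in> measurable (restrict_space lborel {x. infdist x P \<le> 1 / 2}) borel"
    by (intro measurable_restrict_space1) simp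
  then have "emeasure (plane_area P) A = emeasure (restrict_space lborel {x. infdist x P \<le> 1 / 2})
      (closest_point P -` A \<inter> {x. infdist x P \<le> 1 / 2})"
    unfolding plane_area_def using A by (subst emeasure_distr) (auto simp: space_restrict_space)
  also have "\<dots> = emeasure lborel (closest_point P -` A \<inter> {x. infdist x P \<le> 1 / 2})"
    using slab by (intro emeasure_restrict_space) auto
  finally show ?thesis by (simp add: Int_commute)
qed

text \<open>Points of the slab lie within 1/2 of their projection, so the cylinder over a bounded
  set is bounded.\<close>

lemma emeasure_plane_area_finite:
  assumes P: "P \<in> planes" and A: "A \<in> sets borel" "bounded A"
  shows "emeasure (plane_area P) A < \<infinity>"
proof -
  obtain a b where ab: "a \<noteq> 0" "P = {x. a \<bullet> x = b}" using planesE[OF P] .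
  have P': "closed P" "P \<noteq> {}"
    using ab hyperplane_eq_empty[of a b] by (auto simp: closed_hyperplane)
  obtain B where B: "\<And>y. y \<in> A \<Longrightarrow> norm y \<le> B" using A(2) bounded_iff by blast
  have "norm x \<le> B + 1 / 2" if x: "infdist x P \<le> 1 / 2" "closest_point P x \<in> A" for x
  proof -
    obtain y where "y \<in> P" "infdist x P = dist x y" using infdist_attains_inf[OF P'] .
    then have "dist x (closest_point P x) \<le> 1 / 2"
      using closest_point_le[OF P'(1), of y x] x(1) by linarith
    then show ?thesis
      using B[OF x(2)] norm_triangle_ineq2[of x "closest_point P x"] by (simp add: dist_norm)
  qed
  then have "bounded ({x. infdist x P \<le> 1 / 2} \<inter> closest_point P -` A)"
    by (intro boundedI) auto
  then show ?thesis
    unfolding emeasure_plane_area[OF P A(1)] by (rule emeasure_bounded_finite)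
qed

text \<open>The cylinder over a subset of \<open>Q\<close> lies in the set of points whose
  projection to \<open>P\<close> satisfies the equation of \<open>Q\<close>. This is again a linear
  equation: a plane perpendicular to \<open>P\<close> if \<open>P\<close> and \<open>Q\<close>
  intersect, and unsolvable if they are parallel. Only \<open>P = Q\<close> would make it
  trivial.\<close>

lemma emeasure_plane_area_other_plane:
  assumes P: "P \<in> planes" and Q: "Q \<in> planes" "P \<noteq> Q" and A: "A \<in> sets borel" "A \<subseteq> Q"
  shows "emeasure (plane_area P) A = 0"
proof -
  obtain a b where ab: "a \<noteq> 0" "P = {x. a \<bullet> x = b}" using planesE[OF P] .
  obtain c d where cd: "c \<noteq> 0" "Q = {x. c \<bullet> x = d}" using planesE[OF Q(1)] .
  \<comment> \<open>The component of \<open>c\<close> along \<open>a\<close> has coefficient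
    \<open>s\<close>; substituting the projection formula leaves exactly the normal
    \<open>c - s *\<^sub>R a\<close>.\<close>
  define s where "s = (c \<bullet> a) / (a \<bullet> a)"
  have sub: "{x. infdist x P \<le> 1 / 2} \<inter> closest_point P -` A \<subseteq> {x. (c - s *\<^sub>R a) \<bullet> x = d - s * b}"
  proof
    fix x assume "x \<in> {x. infdist x P \<le> 1 / 2} \<inter> closest_point P -` A"
    then have "c \<bullet> (x - ((a \<bullet> x - b) / (a \<bullet> a)) *\<^sub>R a) = d"
      using A(2) cd(2) ab closest_point_hyperplane[OF ab(1)] by auto
    then show "x \<in> {x. (c - s *\<^sub>R a) \<bullet> x = d - s * b}"
      by (simp add: s_def inner_diff_left inner_diff_right field_simps)
         (simp add: add_divide_distrib diff_divide_distrib)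
  qed
  have "c - s *\<^sub>R a \<noteq> 0 \<or> d - s * b \<noteq> 0"
  proof (rule ccontr)
    assume "\<not> ?thesis"
    then have *: "c = s *\<^sub>R a" "d = s * b" by auto
    with cd(1) have "s \<noteq> 0" by auto
    with * have "Q = P" unfolding cd(2) ab(2) by auto
    with Q(2) show False by simp
  qed
  then have "negligible {x. (c - s *\<^sub>R a) \<bullet> x = d - s * b}"
    by (intro negligible_hyperplane)
  then have null: "{x. (c - s *\<^sub>R a) \<bullet> x = d - s * b} \<in> null_sets lborel"
    by (simp add: negligible_iff_null_sets null_sets_completion_iff closed_hyperplane borel_closed)
  show ?thesis
    unfolding emeasure_plane_area[OF P A(1)]
    using emeasure_mono[OF sub, of lborel] null by (auto simp: null_sets_def)
qed

text \<open>The area is a sum over uncountably many planes. A plane outside \<Q> sees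
  \<open>S\<close> as finitely many pieces lying in other planes, each of measure 0, so only a
  finite sum of finite terms is left.\<close>

lemma emeasure_area_finite:
  assumes \<Q>: "finite \<Q>" "\<Q> \<subseteq> planes" and S: "S \<in> sets borel" "bounded S" "S \<subseteq> \<Union>\<Q>"
  shows "emeasure area S < \<infinity>"
proof -
  have zero: "emeasure (plane_area P) S = 0" if P: "P \<in> planes" "P \<notin> \<Q>" for P
  proof -
    have Q: "S \<inter> Q \<in> sets borel" if "Q \<in> \<Q>" for Q
    proof -
      have "Q \<in> planes" using that \<Q>(2) by blast
      then obtain a b where "Q = {x. a \<bullet> x = b}" by (rule planesE)
      then show ?thesis using S(1) by (simp add: borel_closed closed_hyperplane)
    qed
    have "emeasure (plane_area P) (\<Union>Q\<in>\<Q>. S \<inter> Q) \<le> (\<Sum>Q\<in>\<Q>. emeasure (plane_area P) (S \<inter> Q))"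
      using Q by (intro emeasure_subadditive_finite \<Q>) (auto simp: plane_area_def)
    also have "\<dots> = 0"
      using emeasure_plane_area_other_plane[OF P(1)] P(2) \<Q>(2) Q by (intro sum.neutral ballI) blast
    also have "(\<Union>Q\<in>\<Q>. S \<inter> Q) = S" using S(3) by auto
    finally show ?thesis by simp
  qed
  then have sub: "{P \<in> planes. 0 < emeasure (plane_area P) S} \<subseteq> \<Q>" by (auto simp: zero_less_iff_neq_zero)
  with \<Q>(1) have fin: "finite {P \<in> planes. 0 < emeasure (plane_area P) S}" by (rule finite_subset[rotated])
  have "emeasure area S = (\<Sum>P | P \<in> planes \<and> 0 < emeasure (plane_area P) S. emeasure (plane_area P) S)"
    unfolding emeasure_area[OF S(1)] by (rule nn_integral_count_space[OF fin])
  also have "\<dots> < \<infinity>"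
    using fin emeasure_plane_area_finite[OF _ S(1,2)] by simp
  finally show ?thesis .
qed

text \<open>The polytopes in a decomposition may be degenerate. A flat one lies in a plane as a
  whole; for a solid one the frontier is the union of its finitely many facets, of dimension
  2.\<close>

lemma polytope_frontier_subset_planes:
  fixes Q :: "point set"
  assumes "polytope Q"
  shows "\<exists>\<Q>. finite \<Q> \<and> \<Q> \<subseteq> planes \<and> frontier Q \<subseteq> \<Union>\<Q>"
proof -
  have cover: "\<exists>P\<in>planes. F \<subseteq> P" if "aff_dim F < 3" for F :: "point set"
  proof -
    have "aff_dim F < int (DIM(point))" using that by simp
    from aff_lowdim_subset_hyperplane[OF this]
    obtain a b where "a \<noteq> 0" "F \<subseteq> {x. a \<bullet> x = b}" .
    then show ?thesis using hyperplane_in_planes by blast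
  qed
  have closed: "closed Q" using assms polytope_imp_closed by blast
  show ?thesis
  proof (cases "aff_dim Q < 3")
    case True
    then obtain P where "P \<in> planes" "Q \<subseteq> P" using cover by blast
    then show ?thesis using frontier_subset_closed[OF closed] by (intro exI[of _ "{P}"]) auto
  next
    case False
    then have dim: "aff_dim Q = 3" using aff_dim_le_DIM[of Q] by simp
    then have "rel_interior Q = interior Q" by (intro interior_rel_interior) simp
    then have "frontier Q = \<Union> {F. F facet_of Q}"
      using rel_frontier_of_polyhedron[OF polytope_imp_polyhedron[OF assms]]
      by (simp add: frontier_def rel_frontier_def)
    moreover have "\<exists>P. P \<in> planes \<and> F \<subseteq> P" if "F facet_of Q" for F
      using cover[of F] that dim by (auto simp: facet_of_def)
    then obtain p where "\<And>F. F facet_of Q \<Longrightarrow> p F \<in> planes \<and> F \<subseteq> p F"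
      by metis
    ultimately have "frontier Q \<subseteq> \<Union>(p ` {F. F facet_of Q})" "p ` {F. F facet_of Q} \<subseteq> planes"
      by blast+
    then show ?thesis
      using finite_polytope_facets[OF assms] by blast
  qed
qed

lemma finite_measure_area_frontier:
  assumes "polyhedral_domain D"
  shows "finite_measure (restrict_space area (frontier D))"
proof -
  obtain \<P> where \<P>: "finite \<P>" "\<And>Q. Q \<in> \<P> \<Longrightarrow> polytope Q" "closure D = \<Union>\<P>"
    and D: "open D" "bounded D" "interior (closure D) = D"
    using assms unfolding polyhedral_domain_def by blast
  have "\<forall>Q\<in>\<P>. \<exists>\<Q>. finite \<Q> \<and> \<Q> \<subseteq> planes \<and> frontier Q \<subseteq> \<Union>\<Q>"
    using polytope_frontier_subset_planes \<P>(2) by blast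
  then obtain p where p: "\<And>Q. Q \<in> \<P> \<Longrightarrow> finite (p Q) \<and> p Q \<subseteq> planes \<and> frontier Q \<subseteq> \<Union>(p Q)"
    by metis
  have "frontier D \<subseteq> \<Union>(\<Union>(p ` \<P>))"
  proof
    fix x assume "x \<in> frontier D"
    then have x: "x \<in> closure D" "x \<notin> D" using D(1) by (auto simp: frontier_def interior_open)
    then obtain Q where Q: "Q \<in> \<P>" "x \<in> Q" using \<P>(3) by auto
    \<comment> \<open>Here the exclusion of slits enters: an open subset of \<open>closure D\<close>
      lies in \<open>interior (closure D)\<close>, which is \<open>D\<close>. Hence a boundary point
      of \<open>D\<close> in \<open>Q\<close> is a boundary point of \<open>Q\<close>.\<close>
    have "interior Q \<subseteq> D" using Q(1) \<P>(3) D(3) interior_mono[of Q "closure D"] by auto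
    then have "x \<in> frontier Q" using Q(2) x(2) closure_subset by (auto simp: frontier_def)
    then show "x \<in> \<Union>(\<Union>(p ` \<P>))" using p[OF Q(1)] Q(1) by blast
  qed
  then have "emeasure area (frontier D) < \<infinity>"
    using \<P>(1) p compact_imp_bounded[OF compact_frontier_bounded[OF D(2)]]
    by (intro emeasure_area_finite[of "\<Union>(p ` \<P>)"]) (auto simp: borel_closed)
  then show ?thesis
    by (intro finite_measureI) (simp add: emeasure_restrict_space space_restrict_space borel_closed less_top[symmetric])
qed

subsection \<open>Measurability of the normal\<close>

text \<open>A small move from \<open>x\<close> along \<nu>' - \<nu> decreases the product with \<nu>
  and increases the one with \<nu>', because the product of distinct unit vectors is below 1. The
  first normal puts the new point inside \<open>D\<close>, the second outside.\<close>

lemma is_outward_normal_unique: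
  assumes "is_outward_normal D x \<nu>" "is_outward_normal D x \<nu>'"
  shows "\<nu> = \<nu>'"
proof (rule ccontr)
  assume neq: "\<nu> \<noteq> \<nu>'"
  obtain r r' where r: "r > 0" "D \<inter> ball x r = {y \<in> ball x r. \<nu> \<bullet> (y - x) < 0}"
    and r': "r' > 0" "D \<inter> ball x r' = {y \<in> ball x r'. \<nu>' \<bullet> (y - x) < 0}"
    and unit: "norm \<nu> = 1" "norm \<nu>' = 1"
    using assms by (auto simp: is_outward_normal_def)
  \<comment> \<open>The direction has length at most 2, so the division by 3 keeps the moved point
    inside both balls.\<close>
  define t where "t = min r r' / 3"
  have t: "t > 0" using r(1) r'(1) by (simp add: t_def)
  have "norm (\<nu>' - \<nu>) \<le> 2" using norm_triangle_ineq4[of \<nu>' \<nu>] unit by simp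
  then have "t * norm (\<nu>' - \<nu>) \<le> t * 2" using t by simp
  moreover have "t * 2 < r" "t * 2 < r'" using r(1) r'(1) by (auto simp: t_def min_def)
  ultimately have "t * norm (\<nu>' - \<nu>) < r" "t * norm (\<nu>' - \<nu>) < r'" by linarith+
  then have y: "x + t *\<^sub>R (\<nu>' - \<nu>) \<in> ball x r" "x + t *\<^sub>R (\<nu>' - \<nu>) \<in> ball x r'"
    using t by (auto simp: dist_norm)
  have "0 < (norm (\<nu> - \<nu>'))\<^sup>2" using neq by simp
  then have lt: "\<nu> \<bullet> \<nu>' < 1"
    using unit by (simp add: power2_norm_eq_inner inner_diff_left inner_diff_right inner_commute norm_eq_1)
  have "\<nu> \<bullet> (x + t *\<^sub>R (\<nu>' - \<nu>) - x) < 0"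
    using t lt unit by (simp add: inner_diff_right norm_eq_1 mult_less_0_iff)
  then have "x + t *\<^sub>R (\<nu>' - \<nu>) \<in> D" using r(2) y(1) by blast
  then have "\<nu>' \<bullet> (x + t *\<^sub>R (\<nu>' - \<nu>) - x) < 0" using r'(2) y(2) by blast
  then show False
    using t lt unit by (simp add: inner_diff_right norm_eq_1 mult_less_0_iff inner_commute)
qed

lemma outward_normal_eq: "is_outward_normal D x \<nu> \<Longrightarrow> outward_normal D x = \<nu>"
  unfolding outward_normal_def using is_outward_normal_unique by (auto intro!: the_equality)

lemma norm_outward_normal_le: "norm (outward_normal D x) \<le> 1"
proof (cases "\<exists>\<nu>. is_outward_normal D x \<nu>")
  case True
  then show ?thesis by (metis is_outward_normal_def order_refl outward_normal_eq)
qed (simp add: outward_normal_def)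

lemma is_outward_normal_frontier:
  assumes "open D" "is_outward_normal D x \<nu>"
  shows "x \<in> frontier D"
proof -
  obtain r where r: "r > 0" "D \<inter> ball x r = {y \<in> ball x r. \<nu> \<bullet> (y - x) < 0}" and unit: "norm \<nu> = 1"
    using assms by (auto simp: is_outward_normal_def)
  have "x \<notin> {y \<in> ball x r. \<nu> \<bullet> (y - x) < 0}" by simp
  then have "x \<notin> D" using r centre_in_ball by blast
  moreover have "x \<in> closure D"
    unfolding closure_approachable
  proof (intro allI impI)
    fix e :: real assume "e > 0"
    define t where "t = min e r / 2"
    have t: "t > 0" "t < e" "t < r" using \<open>e > 0\<close> r(1) by (auto simp: t_def)
    have "x - t *\<^sub>R \<nu> \<in> {y \<in> ball x r. \<nu> \<bullet> (y - x) < 0}"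
      using t unit by (simp add: dist_norm power2_norm_eq_inner[symmetric])
    then have "x - t *\<^sub>R \<nu> \<in> D" using r(2) by blast
    moreover have "dist (x - t *\<^sub>R \<nu>) x < e" using t unit by (simp add: dist_norm)
    ultimately show "\<exists>y\<in>D. dist y x < e" by blast
  qed
  ultimately show ?thesis using assms(1) by (simp add: frontier_def interior_open)
qed

text \<open>Near \<open>x\<close> the boundary can only lie in the plane through \<open>x\<close>
  with normal \<nu>: one open half ball belongs to \<open>D\<close>, the other is disjoint from
  \<open>D\<close>. The half-space description can then be recentred at any nearby boundary
  point.\<close>

lemma is_outward_normal_locally_constant:
  assumes "open D" "is_outward_normal D x \<nu>"
  shows "\<exists>r>0. \<forall>y\<in>frontier D \<inter> ball x r. is_outward_normal D y \<nu>"
proof -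
  obtain r where r: "r > 0" "D \<inter> ball x r = {y \<in> ball x r. \<nu> \<bullet> (y - x) < 0}" and unit: "norm \<nu> = 1"
    using assms by (auto simp: is_outward_normal_def)
  have "is_outward_normal D y \<nu>" if y: "y \<in> frontier D" "y \<in> ball x r" for y
  proof -
    have yD: "y \<notin> D" "y \<in> closure D"
      using y(1) assms(1) by (auto simp: frontier_def interior_open)
    have "\<not> \<nu> \<bullet> (y - x) < 0" using yD(1) y(2) r(2) by blast
    moreover have "\<not> 0 < \<nu> \<bullet> (y - x)"
    proof
      assume "0 < \<nu> \<bullet> (y - x)"
      then have "y \<in> ball x r \<inter> {z. 0 < \<nu> \<bullet> (z - x)}" using y(2) by simp
      moreover have "open (ball x r \<inter> {z. 0 < \<nu> \<bullet> (z - x)})"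
        by (intro open_Int open_ball open_Collect_less continuous_intros)
      ultimately obtain z where "z \<in> D" "z \<in> ball x r" "0 < \<nu> \<bullet> (z - x)"
        using yD(2) unfolding closure_iff_nhds_not_empty by blast
      then have "z \<in> {y \<in> ball x r. \<nu> \<bullet> (y - x) < 0}" using r(2) by blast
      then show False using \<open>0 < \<nu> \<bullet> (z - x)\<close> by simp
    qed
    ultimately have plane: "\<nu> \<bullet> (z - y) = \<nu> \<bullet> (z - x)" for z
      by (simp add: inner_diff_right)
    define s where "s = r - dist x y"
    have "s > 0" "ball y s \<subseteq> ball x r"
      using y(2) by (auto simp: s_def ball_subset_ball_iff dist_commute)
    then have "D \<inter> ball y s = (D \<inter> ball x r) \<inter> ball y s" by blast
    also have "\<dots> = {z \<in> ball y s. \<nu> \<bullet> (z - y) < 0}"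
      unfolding r(2) plane using \<open>ball y s \<subseteq> ball x r\<close> by blast
    finally show ?thesis
      using \<open>s > 0\<close> unit unfolding is_outward_normal_def by blast
  qed
  with r(1) show ?thesis by blast
qed

text \<open>The points with a normal form a relatively open part of the closed boundary, hence a
  Borel set; on it the normal is locally constant, and elsewhere it has the default value 0.\<close>

lemma measurable_outward_normal:
  assumes "open D"
  shows "outward_normal D \<in> borel_measurable borel"
proof -
  define N where "N = {x. \<exists>\<nu>. is_outward_normal D x \<nu>}"
  have N: "N \<subseteq> frontier D" using is_outward_normal_frontier[OF assms] by (auto simp: N_def)
  have loc: "\<exists>r>0. \<forall>y\<in>frontier D \<inter> ball x r. y \<in> N \<and> outward_normal D y = outward_normal D x" if "x \<in> N" for x
  proof -
    obtain \<nu> where \<nu>: "is_outward_normal D x \<nu>" using \<open>x \<in> N\<close> by (auto simp: N_def)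
    from is_outward_normal_locally_constant[OF assms \<nu>] show ?thesis
      using outward_normal_eq \<nu> by (metis N_def mem_Collect_eq)
  qed
  have "openin (top_of_set (frontier D)) N"
    unfolding openin_contains_ball using N loc by (metis IntE IntI Int_commute subsetI)
  then have "N \<in> sets borel"
    unfolding openin_open by (auto simp: borel_closed borel_open)
  moreover have "continuous_on N (outward_normal D)"
    unfolding continuous_on_iff
  proof (intro ballI allI impI)
    fix x and e :: real assume "x \<in> N" "e > 0"
    obtain r where "r > 0" "\<forall>y\<in>frontier D \<inter> ball x r. y \<in> N \<and> outward_normal D y = outward_normal D x"
      using loc[OF \<open>x \<in> N\<close>] by blast
    then show "\<exists>d>0. \<forall>y\<in>N. dist y x < d \<longrightarrow> dist (outward_normal D y) (outward_normal D x) < e"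
      using N \<open>e > 0\<close> by (intro exI[of _ r]) (auto simp: dist_commute)
  qed
  ultimately have "(\<lambda>x. if x \<in> N then outward_normal D x else 0) \<in> borel_measurable borel"
    by (intro borel_measurable_continuous_on_if) auto
  moreover have "(\<lambda>x. if x \<in> N then outward_normal D x else 0) = outward_normal D"
    by (auto simp: N_def outward_normal_def)
  ultimately show ?thesis by simp
qed

lemma measurable_normal:
  assumes "open D"
  shows "normal D \<in> borel_measurable borel"
proof -
  have "continuous_on UNIV cvec"
    unfolding cvec_def by (intro continuous_intros)
  from measurable_compose[OF measurable_outward_normal[OF assms] borel_measurable_continuous_onI[OF this]]
  show ?thesis by (simp add: normal_def[abs_def])
qed

lemma norm_normal_le: "norm (normal D x) \<le> 1"
proof -
  have "norm (cvec v) = norm v" for v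
    by (simp add: cvec_def norm_vec_def)
  then show ?thesis by (simp add: normal_def norm_outward_normal_le)
qed

subsection \<open>The Trefftz space and the sesquilinear form\<close>

text \<open>The linearity lemmas are stated for \<open>c *s F x + G x\<close> only; a plain multiple
  is obtained from them by taking \<open>G = F\<close> and the coefficient
  \<open>c - 1\<close>.\<close>

lemma scale_diff_one: "(c - 1) *s v + v = (c *s v :: cvec3)"
  by (simp add: vec_eq_iff algebra_simps)

lemma scaleR_eq_scale: "r *\<^sub>R v = of_real r *s (v :: cvec3)"
  by (simp add: vec_eq_iff scaleR_conv_of_real[where 'a = complex])

lemma admissible_elem:
  assumes "admissible p" "k \<in> {1..nelem p}"
  shows "open (elem p k)" "bounded (elem p k)" "finite_measure (bmeasure (elem p k))"
  using assms finite_measure_area_frontier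
  by (auto simp: admissible_def partition_of_def polyhedral_domain_def)

lemma flux_eq:
  assumes "admissible p" "k \<in> {1..nelem p}"
  obtains \<alpha> where "\<alpha> \<noteq> 0" "\<And>F. flux p k F = (\<lambda>x. \<alpha> *s curl (elem p k) F x)"
proof
  have "freq p > 0" "mu p k > 0" using assms unfolding admissible_def by blast+
  then show "1 / (\<i> * of_real (freq p) * of_real (mu p k)) \<noteq> (0::complex)" by simp
qed (simp add: flux_def fun_eq_iff)

text \<open>Curl and flux differ by a nonzero constant on each element, so each supplies what the
  definition states only for the other: the equation gives the flux a curl, and the curl is assumed
  to have a trace.\<close>

lemma trefftz_spaceD:
  assumes p: "admissible p" and k: "k \<in> {1..nelem p}" and F: "F \<in> trefftz_space p"
  shows "F \<in> Hcurl (elem p k)" "curl (elem p k) F \<in> Hcurl (elem p k)" "flux p k F \<in> Hcurl (elem p k)"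
    "has_curl (elem p k) (flux p k F) (\<lambda>x. - ((\<i> * of_real (freq p) * eps p k) *s F x))"
    "\<exists>T. has_trace (elem p k) F T" "\<exists>T. has_trace (elem p k) (curl (elem p k) F) T"
    "\<exists>T. has_trace (elem p k) (flux p k F) T"
proof -
  note D = admissible_elem[OF p k]
  show F1: "F \<in> Hcurl (elem p k)"
    and F2: "has_curl (elem p k) (flux p k F) (\<lambda>x. - ((\<i> * of_real (freq p) * eps p k) *s F x))"
    and F3: "\<exists>T. has_trace (elem p k) F T" "\<exists>T. has_trace (elem p k) (curl (elem p k) F) T"
    using F k by (auto simp: trefftz_space_def local_space_def)
  show flux: "flux p k F \<in> Hcurl (elem p k)" using F2 by (auto simp: Hcurl_def)
  obtain \<alpha> where \<alpha>: "\<alpha> \<noteq> 0" "\<And>F. flux p k F = (\<lambda>x. \<alpha> *s curl (elem p k) F x)"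
    using flux_eq[OF p k] by blast
  have eq: "curl (elem p k) F = (\<lambda>x. (1 / \<alpha> - 1) *s flux p k F x + flux p k F x)"
    unfolding scale_diff_one \<alpha>(2) using \<alpha>(1) by (simp add: vector_smult_assoc)
  then show curl: "curl (elem p k) F \<in> Hcurl (elem p k)"
    by (subst eq) (rule Hcurl_lincomb[OF D(1,2) flux flux])
  have "square_integrable (lebesgue_on (elem p k)) (flux p k F)"
    using F2 by (simp add: has_curl_def)
  then show "\<exists>T. has_trace (elem p k) (flux p k F) T"
    by (rule trace_lincomb(1)[OF D curl curl F3(2) F3(2), of _ "\<alpha> - 1"]) (simp add: scale_diff_one \<alpha>(2))
qed

text \<open>Membership and the three trace identities are proved together, because existence of the
  traces of the combination is part of membership.\<close>

lemma trefftz_space_lincomb: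
  assumes p: "admissible p" and F: "F \<in> trefftz_space p" and G: "G \<in> trefftz_space p"
  shows "(\<lambda>x. c *s F x + G x) \<in> trefftz_space p"
    and "\<And>k. k \<in> {1..nelem p} \<Longrightarrow> AE x in bmeasure (elem p k).
      trace (elem p k) (\<lambda>x. c *s F x + G x) x = c *s trace (elem p k) F x + trace (elem p k) G x"
    and "\<And>k. k \<in> {1..nelem p} \<Longrightarrow> AE x in bmeasure (elem p k).
      trace (elem p k) (curl (elem p k) (\<lambda>x. c *s F x + G x)) x
        = c *s trace (elem p k) (curl (elem p k) F) x + trace (elem p k) (curl (elem p k) G) x"
    and "\<And>k. k \<in> {1..nelem p} \<Longrightarrow> AE x in bmeasure (elem p k).
      trace (elem p k) (flux p k (\<lambda>x. c *s F x + G x)) x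
        = c *s trace (elem p k) (flux p k F) x + trace (elem p k) (flux p k G) x"
proof -
  define H where "H = (\<lambda>x. c *s F x + G x)"
  have local: "H \<in> local_space p k \<and>
      (AE x in bmeasure (elem p k). trace (elem p k) H x = c *s trace (elem p k) F x + trace (elem p k) G x) \<and>
      (AE x in bmeasure (elem p k). trace (elem p k) (curl (elem p k) H) x
        = c *s trace (elem p k) (curl (elem p k) F) x + trace (elem p k) (curl (elem p k) G) x) \<and>
      (AE x in bmeasure (elem p k). trace (elem p k) (flux p k H) x
        = c *s trace (elem p k) (flux p k F) x + trace (elem p k) (flux p k G) x)"
    if k: "k \<in> {1..nelem p}" for k
  proof -
    let ?D = "elem p k"
    note D = admissible_elem[OF p k] and FD = trefftz_spaceD[OF p k F] and GD = trefftz_spaceD[OF p k G]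
    obtain \<alpha> where \<alpha>: "\<And>F. flux p k F = (\<lambda>x. \<alpha> *s curl ?D F x)"
      using flux_eq[OF p k] by blast
    have HH: "H \<in> Hcurl ?D"
      unfolding H_def by (rule Hcurl_lincomb[OF D(1,2) FD(1) GD(1)])
    then have sqH: "square_integrable (lebesgue_on ?D) H" "square_integrable (lebesgue_on ?D) (curl ?D H)"
      using has_curl_curl[OF HH] by (auto simp: has_curl_def)
    then have sqf: "square_integrable (lebesgue_on ?D) (flux p k H)"
      unfolding \<alpha> by (intro square_integrable_scale)
    have AE_H: "AE x in lebesgue_on ?D. c *s F x + G x = H x" by (simp add: H_def)
    have AE_curl: "AE x in lebesgue_on ?D. c *s curl ?D F x + curl ?D G x = curl ?D H x"
      using curl_lincomb[OF D(1,2) FD(1) GD(1), of c] unfolding H_def[symmetric] by eventually_elim simp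
    then have AE_flux: "AE x in lebesgue_on ?D. c *s flux p k F x + flux p k G x = flux p k H x"
      unfolding \<alpha> by eventually_elim (simp add: vec_eq_iff algebra_simps flip: distrib_left)
    have "has_curl ?D (flux p k H) (\<lambda>x. - ((\<i> * of_real (freq p) * eps p k) *s H x))"
    proof (rule has_curl_cong_AE[OF D(1,2) has_curl_lincomb[OF D(1,2) FD(4) GD(4)] sqf AE_flux])
      have "square_integrable (lebesgue_on ?D) (\<lambda>x. (- (\<i> * of_real (freq p) * eps p k)) *s H x)"
        by (rule square_integrable_scale[OF sqH(1)])
      then show "square_integrable (lebesgue_on ?D) (\<lambda>x. - ((\<i> * of_real (freq p) * eps p k) *s H x))"
        by (simp add: vector_scalar_mult_def uminus_vec_def)
      show "AE x in lebesgue_on ?D. c *s - ((\<i> * of_real (freq p) * eps p k) *s F x)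
          + - ((\<i> * of_real (freq p) * eps p k) *s G x) = - ((\<i> * of_real (freq p) * eps p k) *s H x)"
        by (intro AE_I2) (simp add: H_def vec_eq_iff algebra_simps)
    qed
    then have "H \<in> local_space p k"
      using HH trace_lincomb(1)[OF D FD(1) GD(1) FD(5) GD(5) sqH(1) AE_H]
        trace_lincomb(1)[OF D FD(2) GD(2) FD(6) GD(6) sqH(2) AE_curl]
      by (simp add: local_space_def)
    then show ?thesis
      using trace_lincomb(2)[OF D FD(1) GD(1) FD(5) GD(5) sqH(1) AE_H]
        trace_lincomb(2)[OF D FD(2) GD(2) FD(6) GD(6) sqH(2) AE_curl]
        trace_lincomb(2)[OF D FD(3) GD(3) FD(7) GD(7) sqf AE_flux] by blast
  qed
  have "square_integrable (lebesgue_on (domain p)) H"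
    using F G unfolding H_def trefftz_space_def by (intro square_integrable_add square_integrable_scale) auto
  then show "(\<lambda>x. c *s F x + G x) \<in> trefftz_space p"
    using local by (simp add: trefftz_space_def H_def)
  show "AE x in bmeasure (elem p k).
      trace (elem p k) (\<lambda>x. c *s F x + G x) x = c *s trace (elem p k) F x + trace (elem p k) G x"
    "AE x in bmeasure (elem p k). trace (elem p k) (curl (elem p k) (\<lambda>x. c *s F x + G x)) x
        = c *s trace (elem p k) (curl (elem p k) F) x + trace (elem p k) (curl (elem p k) G) x"
    "AE x in bmeasure (elem p k). trace (elem p k) (flux p k (\<lambda>x. c *s F x + G x)) x
        = c *s trace (elem p k) (flux p k F) x + trace (elem p k) (flux p k G) x"
    if "k \<in> {1..nelem p}" for k
    using local[OF that] by (auto simp: H_def)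
qed

text \<open>The common properties of jump, flux jump and impedance on which the algebra of
  \<open>a\<close> rests. Linearity holds almost everywhere, and the exceptional null set may depend
  on \<open>F\<close>, \<open>G\<close> and \<open>c\<close>.\<close>

definition trace_operator :: "field3 set \<Rightarrow> point measure \<Rightarrow> (field3 \<Rightarrow> field3) \<Rightarrow> bool" where
  "trace_operator V M A \<longleftrightarrow> (\<forall>F\<in>V. square_integrable M (A F)) \<and>
     (\<forall>F\<in>V. \<forall>G\<in>V. \<forall>c. AE x in M. A (\<lambda>x. c *s F x + G x) x = c *s A F x + A G x)"

lemma trace_operator_subset:
  assumes A: "trace_operator V (restrict_space area S) A" and TS: "T \<subseteq> S" "S \<in> sets borel" "T \<in> sets borel"
  shows "trace_operator V (restrict_space area T) A"
proof -
  have "AE x in restrict_space area T. P x" if "AE x in restrict_space area S. P x" for P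
    using that TS by (auto simp: AE_restrict_space_iff elim!: eventually_mono)
  then show ?thesis
    using A square_integrable_subset[of area S _ T] TS unfolding trace_operator_def by auto
qed

lemma trace_operator_add:
  assumes "trace_operator V M A" "trace_operator V M B"
  shows "trace_operator V M (\<lambda>F x. A F x + B F x)"
  unfolding trace_operator_def
proof (intro conjI ballI allI)
  fix F G c assume FG: "F \<in> V" "G \<in> V"
  show "square_integrable M (\<lambda>x. A F x + B F x)"
    using assms FG by (intro square_integrable_add) (auto simp: trace_operator_def)
  have "AE x in M. A (\<lambda>x. c *s F x + G x) x = c *s A F x + A G x"
    "AE x in M. B (\<lambda>x. c *s F x + G x) x = c *s B F x + B G x"
    using assms FG by (auto simp: trace_operator_def)
  then show "AE x in M. A (\<lambda>x. c *s F x + G x) x + B (\<lambda>x. c *s F x + G x) x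
      = c *s (A F x + B F x) + (A G x + B G x)"
    by eventually_elim (simp add: vec_eq_iff algebra_simps)
qed

lemma trace_operator_scale:
  assumes "trace_operator V M A"
  shows "trace_operator V M (\<lambda>F x. a *s A F x)"
  unfolding trace_operator_def
proof (intro conjI ballI allI)
  fix F G c assume FG: "F \<in> V" "G \<in> V"
  show "square_integrable M (\<lambda>x. a *s A F x)"
    using assms FG by (intro square_integrable_scale) (auto simp: trace_operator_def)
  have "AE x in M. A (\<lambda>x. c *s F x + G x) x = c *s A F x + A G x"
    using assms FG by (auto simp: trace_operator_def)
  then show "AE x in M. a *s A (\<lambda>x. c *s F x + G x) x = c *s (a *s A F x) + a *s A G x"
    by eventually_elim (simp add: vec_eq_iff algebra_simps)
qed

lemma trace_operator_ccross:
  assumes A: "trace_operator V M A" and \<nu>: "\<nu> \<in> borel_measurable M" "\<And>x. norm (\<nu> x) \<le> 1"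
  shows "trace_operator V M (\<lambda>F x. ccross (A F x) (\<nu> x))"
  unfolding trace_operator_def
proof (intro conjI ballI allI)
  fix F G c assume FG: "F \<in> V" "G \<in> V"
  then have sq: "square_integrable M (A F)" using A by (simp add: trace_operator_def)
  note [measurable] = square_integrable_measurable[OF sq] \<nu>(1)
  show "square_integrable M (\<lambda>x. ccross (A F x) (\<nu> x))"
  proof (rule square_integrable_bound[OF sq])
    show "norm (ccross (A F x) (\<nu> x)) \<le> 6 * norm (A F x)" for x
      using norm_ccross_le[of "A F x" "\<nu> x"] mult_left_le[OF \<nu>(2)[of x] norm_ge_zero[of "A F x"]] by linarith
  qed measurable
  have "AE x in M. A (\<lambda>x. c *s F x + G x) x = c *s A F x + A G x"
    using A FG by (auto simp: trace_operator_def)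
  then show "AE x in M. ccross (A (\<lambda>x. c *s F x + G x) x) (\<nu> x)
      = c *s ccross (A F x) (\<nu> x) + ccross (A G x) (\<nu> x)"
    by eventually_elim (simp add: ccross_add_left ccross_scale_left)
qed

section \<open>Hermitian forms induced by trace operators\<close>

definition hform :: "point measure \<Rightarrow> (field3 \<Rightarrow> field3) \<Rightarrow> field3 \<Rightarrow> field3 \<Rightarrow> complex" where
  "hform M A F G = (\<integral>x. cdot (A F x) (vcnj (A G x)) \<partial>M)"

lemma hform_integrable:
  "trace_operator V M A \<Longrightarrow> F \<in> V \<Longrightarrow> G \<in> V \<Longrightarrow> integrable M (\<lambda>x. cdot (A F x) (vcnj (A G x)))"
  by (intro integrable_cdot square_integrable_vcnj) (auto simp: trace_operator_def)

lemma hform_lincomb: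
  assumes A: "trace_operator V M A" and V: "F \<in> V" "G \<in> V" "K \<in> V" "(\<lambda>x. c *s F x + G x) \<in> V"
  shows "hform M A (\<lambda>x. c *s F x + G x) K = c * hform M A F K + hform M A G K"
proof -
  note int = hform_integrable[OF A _ V(3)]
  note [measurable] = int[THEN borel_measurable_integrable]
  have "hform M A (\<lambda>x. c *s F x + G x) K
      = (\<integral>x. c * cdot (A F x) (vcnj (A K x)) + cdot (A G x) (vcnj (A K x)) \<partial>M)"
    unfolding hform_def
  proof (rule integral_cong_AE)
    have "AE x in M. A (\<lambda>x. c *s F x + G x) x = c *s A F x + A G x"
      using A V by (auto simp: trace_operator_def)
    then show "AE x in M. cdot (A (\<lambda>x. c *s F x + G x) x) (vcnj (A K x))
        = c * cdot (A F x) (vcnj (A K x)) + cdot (A G x) (vcnj (A K x))"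
      by eventually_elim (simp add: cdot_add_left cdot_scale_left)
  qed (use int[OF V(1)] int[OF V(2)] int[OF V(4)] in \<open>auto intro!: borel_measurable_add borel_measurable_times dest!: borel_measurable_integrable\<close>)
  also have "\<dots> = c * hform M A F K + hform M A G K"
    using int[OF V(1)] int[OF V(2)] by (simp add: hform_def)
  finally show ?thesis .
qed

lemma Re_hform_nonneg:
  assumes "trace_operator V M A" "F \<in> V"
  shows "0 \<le> Re (hform M A F F)"
proof -
  have "Re (hform M A F F) = (\<integral>x. Re (cdot (A F x) (vcnj (A F x))) \<partial>M)"
    unfolding hform_def using hform_integrable[OF assms assms(2)] by simp
  also have "\<dots> \<ge> 0" by (rule integral_nonneg_AE) (simp add: Re_cdot_vcnj)
  finally show ?thesis .
qed

lemma trace_operator_trace: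
  assumes p: "admissible p" and k: "k \<in> {1..nelem p}"
  shows "trace_operator (trefftz_space p) (bmeasure (elem p k)) (trace (elem p k))"
    "trace_operator (trefftz_space p) (bmeasure (elem p k)) (\<lambda>F. trace (elem p k) (curl (elem p k) F))"
    "trace_operator (trefftz_space p) (bmeasure (elem p k)) (\<lambda>F. trace (elem p k) (flux p k F))"
proof -
  have "square_integrable (bmeasure (elem p k)) (trace (elem p k) F)" if "\<exists>T. has_trace (elem p k) F T" for F
    using that has_trace_trace has_trace_def by blast
  then show "trace_operator (trefftz_space p) (bmeasure (elem p k)) (trace (elem p k))"
    "trace_operator (trefftz_space p) (bmeasure (elem p k)) (\<lambda>F. trace (elem p k) (curl (elem p k) F))"
    "trace_operator (trefftz_space p) (bmeasure (elem p k)) (\<lambda>F. trace (elem p k) (flux p k F))"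
    unfolding trace_operator_def
    using trefftz_spaceD(5-7)[OF p k] trefftz_space_lincomb(2-4)[OF p _ _ k] by blast+
qed

lemma trace_operator_aform:
  assumes p: "admissible p" and k: "k \<in> {1..nelem p}"
  shows "trace_operator (trefftz_space p) (restrict_space area (bface p k)) (impedance p k)"
    and "j \<in> {1..nelem p} \<Longrightarrow> trace_operator (trefftz_space p) (restrict_space area (iface p k j)) (jump p k j)"
    and "j \<in> {1..nelem p} \<Longrightarrow> trace_operator (trefftz_space p) (restrict_space area (iface p k j)) (flux_jump p k j)"
proof -
  note D = admissible_elem[OF p k]
  \<comment> \<open>The element lies in the open domain, so a boundary point of the domain cannot
    belong to the element; being in its closure, it is on its frontier.\<close>
  have sub: "bface p k \<subseteq> frontier (elem p k)"
  proof -
    have "open (domain p)" "elem p k \<subseteq> domain p"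
      using p k by (auto simp: admissible_def polyhedral_domain_def partition_of_def)
    then show ?thesis
      using D(1) by (auto simp: bface_def frontier_def interior_open)
  qed
  have bor: "bface p k \<in> sets borel" "iface p k j \<in> sets borel" for j
    by (auto simp: bface_def iface_def intro!: borel_closed)
  have "normal (elem p k) \<in> borel_measurable (bmeasure (elem p k))"
    unfolding measurable_cong_sets[OF sets_area refl, symmetric]
    by (rule measurable_restrict_space1) (simp only: measurable_cong_sets[OF sets_area refl] measurable_normal[OF D(1)])
  then have "trace_operator (trefftz_space p) (bmeasure (elem p k))
      (\<lambda>F x. (-1) *s trace (elem p k) F x + (vsig p k / (\<i> * of_real (freq p) * of_real (mu p k))) *s
        ccross (trace (elem p k) (curl (elem p k) F) x) (normal (elem p k) x))"
    by (intro trace_operator_add trace_operator_scale trace_operator_ccross trace_operator_trace p k norm_normal_le)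
  also have "(\<lambda>F x. (-1) *s trace (elem p k) F x + (vsig p k / (\<i> * of_real (freq p) * of_real (mu p k))) *s
        ccross (trace (elem p k) (curl (elem p k) F) x) (normal (elem p k) x)) = impedance p k"
    by (simp add: impedance_def fun_eq_iff vector_sneg_minus1[symmetric])
  finally show "trace_operator (trefftz_space p) (restrict_space area (bface p k)) (impedance p k)"
    by (rule trace_operator_subset[OF _ sub]) (auto intro: bor borel_closed)
  assume j: "j \<in> {1..nelem p}"
  have sub': "iface p k j \<subseteq> frontier (elem p k)" "iface p k j \<subseteq> frontier (elem p j)"
    by (auto simp: iface_def)
  have *: "trace_operator (trefftz_space p) (restrict_space area (iface p k j)) A"
    if "trace_operator (trefftz_space p) (bmeasure (elem p l)) A" "l \<in> {k, j}" for A l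
    by (rule trace_operator_subset[OF that(1)]) (use that(2) sub' bor in \<open>auto intro: borel_closed\<close>)
  show "trace_operator (trefftz_space p) (restrict_space area (iface p k j)) (jump p k j)"
    using trace_operator_add[OF *[OF trace_operator_trace(1)[OF p k]] *[OF trace_operator_trace(1)[OF p j]]]
    by (simp add: jump_def[abs_def])
  show "trace_operator (trefftz_space p) (restrict_space area (iface p k j)) (flux_jump p k j)"
    using trace_operator_add[OF *[OF trace_operator_trace(3)[OF p k]] *[OF trace_operator_trace(3)[OF p j]]]
    by (simp add: flux_jump_def[abs_def])
qed

text \<open>Splitting the interface integral into its two parts requires the integrability of both,
  which membership in the Trefftz space provides.\<close>

lemma aform_eq_hform:
  assumes p: "admissible p" and V: "F \<in> trefftz_space p" "G \<in> trefftz_space p"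
  shows "aform p F G =
     (\<Sum>j\<in>{1..nelem p}. \<Sum>k\<in>{1..<j}.
          of_real (rho1 p) * hform (restrict_space area (iface p k j)) (jump p k j) F G
        + of_real (rho2 p) * hform (restrict_space area (iface p k j)) (flux_jump p k j) F G)
   + (\<Sum>k\<in>{1..nelem p}. hform (restrict_space area (bface p k)) (impedance p k) F G)"
proof -
  have "(\<integral>x. of_real (rho1 p) * cdot (jump p k j F x) (vcnj (jump p k j G x))
        + of_real (rho2 p) * cdot (flux_jump p k j F x) (vcnj (flux_jump p k j G x))
        \<partial>restrict_space area (iface p k j))
      = of_real (rho1 p) * hform (restrict_space area (iface p k j)) (jump p k j) F G
        + of_real (rho2 p) * hform (restrict_space area (iface p k j)) (flux_jump p k j) F G"
    if "k \<in> {1..nelem p}" "j \<in> {1..nelem p}" for k j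
    using hform_integrable[OF trace_operator_aform(2)[OF p that] V] hform_integrable[OF trace_operator_aform(3)[OF p that] V]
    by (simp add: hform_def)
  then show ?thesis
    unfolding aform_def by (intro arg_cong2[where f = "(+)"] sum.cong refl) (auto simp: hform_def)
qed

lemma aform_lincomb:
  assumes p: "admissible p" and V: "F \<in> trefftz_space p" "G \<in> trefftz_space p" "K \<in> trefftz_space p"
  shows "aform p (\<lambda>x. c *s F x + G x) K = c * aform p F K + aform p G K"
proof -
  note H = trefftz_space_lincomb(1)[OF p V(1,2), of c]
  have 1: "hform (restrict_space area (iface p k j)) (jump p k j) (\<lambda>x. c *s F x + G x) K
      = c * hform (restrict_space area (iface p k j)) (jump p k j) F K + hform (restrict_space area (iface p k j)) (jump p k j) G K"
    "hform (restrict_space area (iface p k j)) (flux_jump p k j) (\<lambda>x. c *s F x + G x) K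
      = c * hform (restrict_space area (iface p k j)) (flux_jump p k j) F K + hform (restrict_space area (iface p k j)) (flux_jump p k j) G K"
    if "j \<in> {1..nelem p}" "k \<in> {1..<j}" for k j
    using that by (auto intro!: hform_lincomb[OF trace_operator_aform(2)[OF p]] hform_lincomb[OF trace_operator_aform(3)[OF p]] V H)
  have 2: "hform (restrict_space area (bface p k)) (impedance p k) (\<lambda>x. c *s F x + G x) K
      = c * hform (restrict_space area (bface p k)) (impedance p k) F K + hform (restrict_space area (bface p k)) (impedance p k) G K"
    if "k \<in> {1..nelem p}" for k
    by (rule hform_lincomb[OF trace_operator_aform(1)[OF p that] V H])
  show ?thesis
    unfolding aform_eq_hform[OF p H V(3)] aform_eq_hform[OF p V(1,3)] aform_eq_hform[OF p V(2,3)]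
    using 1 2 by (simp add: sum.distrib sum_distrib_left algebra_simps)
qed

text \<open>This holds for arbitrary fields: the Bochner integral commutes with conjugation also for
  non-integrable functions, where both sides are 0.\<close>

lemma aform_cnj: "aform p G F = cnj (aform p F G)"
proof -
  have 1: "(\<integral>x. of_real (rho1 p) * cdot (jump p k j G x) (vcnj (jump p k j F x))
        + of_real (rho2 p) * cdot (flux_jump p k j G x) (vcnj (flux_jump p k j F x)) \<partial>M)
      = cnj (\<integral>x. of_real (rho1 p) * cdot (jump p k j F x) (vcnj (jump p k j G x))
        + of_real (rho2 p) * cdot (flux_jump p k j F x) (vcnj (flux_jump p k j G x)) \<partial>M)" for k j M
    unfolding Bochner_Integration.integral_cnj[symmetric]
    by (rule Bochner_Integration.integral_cong)
       (simp_all only: complex_cnj_add complex_cnj_mult complex_cnj_complex_of_real cdot_vcnj_commute[symmetric])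
  have 2: "(\<integral>x. cdot (impedance p k G x) (vcnj (impedance p k F x)) \<partial>M)
      = cnj (\<integral>x. cdot (impedance p k F x) (vcnj (impedance p k G x)) \<partial>M)" for k M
    by (simp only: Bochner_Integration.integral_cnj[symmetric] cdot_vcnj_commute[symmetric])
  show ?thesis
    unfolding aform_def by (simp only: 1[of _ _] 2[of _ _] complex_cnj_add cnj_sum)
qed

lemma Re_aform_nonneg:
  assumes p: "admissible p" and F: "F \<in> trefftz_space p"
  shows "0 \<le> Re (aform p F F)"
proof -
  have n1: "0 \<le> Re (of_real (rho1 p) * hform (restrict_space area (iface p k j)) (jump p k j) F F
        + of_real (rho2 p) * hform (restrict_space area (iface p k j)) (flux_jump p k j) F F)"
    if "k \<in> {1..nelem p}" "j \<in> {1..nelem p}" for k j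
    using p Re_hform_nonneg[OF trace_operator_aform(2)[OF p that] F] Re_hform_nonneg[OF trace_operator_aform(3)[OF p that] F]
    by (simp add: admissible_def)
  have n2: "0 \<le> Re (hform (restrict_space area (bface p k)) (impedance p k) F F)" if "k \<in> {1..nelem p}" for k
    by (rule Re_hform_nonneg[OF trace_operator_aform(1)[OF p that] F])
  have "0 \<le> (\<Sum>j\<in>{1..nelem p}. \<Sum>k\<in>{1..<j}.
        Re (of_real (rho1 p) * hform (restrict_space area (iface p k j)) (jump p k j) F F
          + of_real (rho2 p) * hform (restrict_space area (iface p k j)) (flux_jump p k j) F F))"
    by (intro sum_nonneg n1) auto
  moreover have "0 \<le> (\<Sum>k\<in>{1..nelem p}. Re (hform (restrict_space area (bface p k)) (impedance p k) F F))"
    by (intro sum_nonneg n2)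
  ultimately show ?thesis
    by (simp add: aform_eq_hform[OF p F F])
qed

lemma Re_aform_commute: "Re (aform p F G) = Re (aform p G F)"
  using aform_cnj[of p F G] by simp

text \<open>The second argument is handled through the symmetry of the real part. With a real
  coefficient the two mixed terms coincide.\<close>

lemma Re_aform_quadratic:
  assumes p: "admissible p" and V: "F \<in> trefftz_space p" "G \<in> trefftz_space p"
  shows "Re (aform p (\<lambda>x. of_real r *s F x + G x) (\<lambda>x. of_real r *s F x + G x))
    = r\<^sup>2 * Re (aform p F F) + 2 * r * Re (aform p F G) + Re (aform p G G)"
proof -
  note H = trefftz_space_lincomb(1)[OF p V, of "of_real r"]
  have *: "Re (aform p K (\<lambda>x. of_real r *s F x + G x)) = r * Re (aform p K F) + Re (aform p K G)"
    if "K \<in> trefftz_space p" for K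
    using aform_lincomb[OF p V that, of "of_real r"] Re_aform_commute[of p K] by simp
  show ?thesis
    using aform_lincomb[OF p V H, of "of_real r"] *[OF V(1)] *[OF V(2)] Re_aform_commute[of p F G]
    by (simp add: power2_eq_square algebra_simps)
qed

subsection \<open>Convergence of the recursive procedure\<close>

lemma cspan_lincomb:
  assumes "F \<in> cspan \<phi> j" "G \<in> cspan \<phi> j"
  shows "(\<lambda>x. c *s F x + G x) \<in> cspan \<phi> j"
proof -
  obtain a b where "F = (\<lambda>x. \<Sum>l\<in>{1..j}. a l *s \<phi> l x)" "G = (\<lambda>x. \<Sum>l\<in>{1..j}. b l *s \<phi> l x)"
    using assms by (auto simp: cspan_def)
  then have "(\<lambda>x. c *s F x + G x) = (\<lambda>x. \<Sum>l\<in>{1..j}. (c * a l + b l) *s \<phi> l x)"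
    by (simp add: vec_eq_iff fun_eq_iff sum.distrib sum_distrib_left algebra_simps)
  then show ?thesis unfolding cspan_def by (intro CollectI exI[of _ "\<lambda>l. c * a l + b l"])
qed

lemma cspan_Suc: "cspan \<phi> j \<subseteq> cspan \<phi> (Suc j)"
proof
  fix F assume "F \<in> cspan \<phi> j"
  then obtain a where "F = (\<lambda>x. \<Sum>l\<in>{1..j}. a l *s \<phi> l x)" by (auto simp: cspan_def)
  then have "F = (\<lambda>x. \<Sum>l\<in>{1..Suc j}. (if l \<le> j then a l else 0) *s \<phi> l x)" by simp
  then show "F \<in> cspan \<phi> (Suc j)"
    unfolding cspan_def by (intro CollectI exI[of _ "\<lambda>l. if l \<le> j then a l else 0"])
qed

lemma cspan_self: "\<phi> (Suc j) \<in> cspan \<phi> (Suc j)"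
proof -
  have "\<phi> (Suc j) = (\<lambda>x. \<Sum>l\<in>{1..Suc j}. (if l \<le> j then 0 else 1) *s \<phi> l x)" by simp
  then show ?thesis unfolding cspan_def by (intro CollectI exI[of _ "\<lambda>l. if l \<le> j then 0 else 1"])
qed

lemma cspan_subset_trefftz_space:
  assumes p: "admissible p" and 0: "(\<lambda>x. 0) \<in> trefftz_space p"
    and \<phi>: "\<And>l. l \<in> {1..j} \<Longrightarrow> \<phi> l \<in> trefftz_space p"
  shows "cspan \<phi> j \<subseteq> trefftz_space p"
proof -
  have "(\<lambda>x. \<Sum>l\<in>{1..m}. a l *s \<phi> l x) \<in> trefftz_space p" if "m \<le> j" for a :: "nat \<Rightarrow> complex" and m
    using that
  proof (induction m)
    case (Suc m)
    then have "(\<lambda>x. a (Suc m) *s \<phi> (Suc m) x + (\<Sum>l\<in>{1..m}. a l *s \<phi> l x)) \<in> trefftz_space p"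
      by (intro trefftz_space_lincomb(1)[OF p] \<phi>) auto
    then show ?case by (simp add: add.commute)
  qed (simp add: 0)
  then show ?thesis by (auto simp: cspan_def)
qed

text \<open>The Galerkin error \<open>f\<close> is at most the error \<open>e - b \<phi>\<close> of the optimal multiple of \<open>\<phi>\<close>. The
  angle condition gives \<open>b / d \<ge> 1 - \<delta>\<^sup>2 / 2\<close>, and \<open>1 - (1 - \<delta>\<^sup>2 / 2)\<^sup>2 = \<delta>\<^sup>2 - \<delta>\<^sup>4 / 4\<close> is strictly
  below \<open>\<delta>\<^sup>2\<close>.\<close>

lemma dgnorm_Galerkin_less:
  assumes p: "admissible p" and V: "e \<in> trefftz_space p" "f \<in> trefftz_space p" "\<phi> \<in> trefftz_space p"
    and \<phi>: "dgnorm p \<phi> = 1" and \<delta>: "0 < \<delta>" "\<delta> < 1"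
    and d: "dgnorm p e > 0"
    and close: "dgnorm p (\<lambda>x. \<phi> x - e x /\<^sub>R dgnorm p e) \<le> \<delta>"
    and orth: "\<And>b. aform p f (\<lambda>x. e x - of_real b *s \<phi> x - f x) = 0"
  shows "dgnorm p f < dgnorm p e * \<delta>"
proof -
  define N where "N F = Re (aform p F F)" for F
  define d where "d = dgnorm p e"
  \<comment> \<open>Since \<phi> has norm 1, this is the minimizer of the squared norm of
    \<open>e - r \<phi>\<close> over real \<open>r\<close>.\<close>
  define b where "b = Re (aform p e \<phi>)"
  have d_pos: "d > 0" using d by (simp add: d_def)
  have Ne: "N e = d\<^sup>2" using Re_aform_nonneg[OF p V(1)] by (simp add: d_def dgnorm_def N_def)
  have N\<phi>: "N \<phi> = 1" using \<phi> by (simp add: dgnorm_def N_def real_sqrt_eq_1_iff)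
  have "(\<lambda>x. \<phi> x - e x /\<^sub>R d) = (\<lambda>x. of_real (- inverse d) *s e x + \<phi> x)"
    by (simp add: scaleR_eq_scale vec_eq_iff fun_eq_iff)
  then have "N (\<lambda>x. \<phi> x - e x /\<^sub>R d) = 2 - 2 * (b / d)"
    using Re_aform_quadratic[OF p V(1,3), of "- inverse d"] Ne N\<phi> d_pos
    by (simp add: N_def b_def divide_inverse flip: power_mult_distrib)
  moreover have "N (\<lambda>x. \<phi> x - e x /\<^sub>R d) \<le> \<delta>\<^sup>2"
    using close unfolding d_def[symmetric] dgnorm_def[of p "\<lambda>x. \<phi> x - e x /\<^sub>R d"] N_def
    by (rule sqrt_le_D)
  ultimately have angle: "1 - \<delta>\<^sup>2 / 2 \<le> b / d" by simp
  \<comment> \<open>The field \<open>e - b \<phi>\<close> splits into \<open>w + f\<close>, and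
    \<open>orth\<close> makes the two orthogonal. Pythagoras then bounds \<open>N f\<close> by the
    minimum d^2 - b^2.\<close>
  define w where "w = (\<lambda>x. e x - of_real b *s \<phi> x - f x)"
  have eb: "(\<lambda>x. e x - of_real b *s \<phi> x) = (\<lambda>x. of_real (- b) *s \<phi> x + e x)"
    by (simp add: vec_eq_iff fun_eq_iff)
  then have eb_V: "(\<lambda>x. e x - of_real b *s \<phi> x) \<in> trefftz_space p"
    using trefftz_space_lincomb(1)[OF p V(3,1), of "of_real (- b)"] by simp
  have "w = (\<lambda>x. (-1) *s f x + (e x - of_real b *s \<phi> x))"
    by (simp add: w_def vec_eq_iff fun_eq_iff)
  then have w: "w \<in> trefftz_space p"
    using trefftz_space_lincomb(1)[OF p V(2) eb_V, of "-1"] by simp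
  have "(\<lambda>x. e x - of_real b *s \<phi> x) = (\<lambda>x. of_real 1 *s w x + f x)"
    by (simp add: w_def vec_eq_iff fun_eq_iff)
  then have "N (\<lambda>x. e x - of_real b *s \<phi> x) = N w + N f"
    using Re_aform_quadratic[OF p w V(2), of 1] orth[of b] Re_aform_commute[of p w f]
    by (simp add: N_def w_def)
  moreover have "N (\<lambda>x. e x - of_real b *s \<phi> x) = d\<^sup>2 - b\<^sup>2"
    unfolding eb using Re_aform_quadratic[OF p V(3,1), of "- b"] Ne N\<phi> Re_aform_commute[of p \<phi> e]
    by (simp add: N_def b_def power2_eq_square)
  ultimately have "N f \<le> d\<^sup>2 - b\<^sup>2"
    using Re_aform_nonneg[OF p w] by (simp add: N_def)
  also have "d\<^sup>2 - b\<^sup>2 = d\<^sup>2 * (1 - (b / d)\<^sup>2)"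
    using d_pos by (simp add: field_simps)
  also have "\<dots> \<le> d\<^sup>2 * (1 - (1 - \<delta>\<^sup>2 / 2)\<^sup>2)"
  proof -
    \<comment> \<open>This keeps the lower bound for \<open>b / d\<close> nonnegative, so that
      squaring preserves the inequality.\<close>
    have "\<delta>\<^sup>2 \<le> 1" using \<delta> by (simp add: power_le_one)
    then have "(1 - \<delta>\<^sup>2 / 2)\<^sup>2 \<le> (b / d)\<^sup>2" using angle by (intro power_mono) auto
    then show ?thesis by (intro mult_left_mono) auto
  qed
  also have "\<dots> < d\<^sup>2 * \<delta>\<^sup>2"
  proof -
    have "1 - (1 - \<delta>\<^sup>2 / 2)\<^sup>2 = \<delta>\<^sup>2 - (\<delta>\<^sup>2)\<^sup>2 / 4" by (simp add: power2_eq_square algebra_simps)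
    also have "\<dots> < \<delta>\<^sup>2" using \<delta> by simp
    finally show ?thesis using d_pos by simp
  qed
  finally have "N f < (d * \<delta>)\<^sup>2" by (simp add: power_mult_distrib)
  then have "sqrt (N f) < d * \<delta>"
    using d_pos \<delta> by (intro real_less_lsqrt) auto
  then show ?thesis by (simp add: dgnorm_def N_def d_def)
qed

theorem theorem5p1:
  fixes p :: maxwell and E :: field3 and i :: nat
    and \<epsilon> :: "nat \<Rightarrow> real" and ms ts :: "nat \<Rightarrow> nat" and Eh \<phi> :: "nat \<Rightarrow> field3"
  assumes "admissible p"
    and "unique_solution p E"
    and "i \<ge> 1"
    and "\<forall>j\<in>{1..i}. \<epsilon> j \<in> {0<..<1}"
    and "\<forall>j\<in>{1..i}. ms j > 0 \<and> ts j > 0"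
    and "dgpwnn p E i \<epsilon> ms ts Eh \<phi>"
    and "\<forall>j\<in>{1..i}. dgnorm p (\<lambda>x. E x - Eh (j - 1) x) > 0"
    and "\<forall>j\<in>{1..i}.
      dgnorm p (\<lambda>x. \<phi> j x - (E x - Eh (j - 1) x) /\<^sub>R dgnorm p (\<lambda>x. E x - Eh (j - 1) x)) \<le> \<epsilon> j"
  shows "dgnorm p (\<lambda>x. E x - Eh i x) < dgnorm p (\<lambda>x. E x - Eh 0 x) * (\<Prod>j=1..i. \<epsilon> j)"
proof -
  note p = assms(1)
  have E: "E \<in> trefftz_space p" "\<And>F. F \<in> trefftz_space p \<Longrightarrow> aform p E F = Lform p F"
    using assms(2) by (auto simp: unique_solution_def solves_def)
  have Eh0: "Eh 0 = (\<lambda>x. 0)"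
    and \<phi>: "\<And>j. j \<in> {1..i} \<Longrightarrow> \<phi> j \<in> trefftz_space p \<and> dgnorm p (\<phi> j) = 1"
    and Eh: "\<And>j. j \<in> {1..i} \<Longrightarrow> Eh j \<in> cspan \<phi> j"
      "\<And>j F. j \<in> {1..i} \<Longrightarrow> F \<in> cspan \<phi> j \<Longrightarrow> aform p (Eh j) F = Lform p F"
    using assms(6) by (auto simp: dgpwnn_def quasi_maximizer_def dgball_def solves_def)
  \<comment> \<open>Written as -E + E, the zero field inherits membership, including the existence
    of its traces, from closure under combinations.\<close>
  have zero: "(\<lambda>x. 0) \<in> trefftz_space p"
    using trefftz_space_lincomb(1)[OF p E(1) E(1), of "-1"] by (simp add: vector_sneg_minus1[symmetric])
  have span: "cspan \<phi> j \<subseteq> trefftz_space p" if "j \<le> i" for j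
    using that \<phi> by (intro cspan_subset_trefftz_space[OF p zero]) auto
  \<comment> \<open>The start value \<open>Eh 0 = 0\<close> is the empty sum, so the first step
    needs no separate treatment.\<close>
  have Eh_span: "Eh j \<in> cspan \<phi> j" if "j \<le> i" for j
    using that Eh(1)[of j] by (cases "j = 0") (auto simp: Eh0 cspan_def)
  have diff_eq: "(\<lambda>x. F x - G x) = (\<lambda>x. (-1) *s G x + F x)" for F G :: field3
    by (simp add: vec_eq_iff fun_eq_iff)
  have diff: "(\<lambda>x. E x - Eh j x) \<in> trefftz_space p" if "j \<le> i" for j
    unfolding diff_eq using Eh_span[OF that] span[OF that] by (intro trefftz_space_lincomb(1)[OF p _ E(1)]) auto
  have step: "dgnorm p (\<lambda>x. E x - Eh (Suc j) x) < dgnorm p (\<lambda>x. E x - Eh j x) * \<epsilon> (Suc j)" if j: "Suc j \<le> i" for j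
  proof (rule dgnorm_Galerkin_less[OF p, where \<phi> = "\<phi> (Suc j)"])
    have S: "Suc j \<in> {1..i}" using j by simp
    show "0 < \<epsilon> (Suc j)" "\<epsilon> (Suc j) < 1" using assms(4) S by auto
    show "0 < dgnorm p (\<lambda>x. E x - Eh j x)"
      "dgnorm p (\<lambda>x. \<phi> (Suc j) x - (E x - Eh j x) /\<^sub>R dgnorm p (\<lambda>x. E x - Eh j x)) \<le> \<epsilon> (Suc j)"
      using assms(7,8) S by force+
    show "\<phi> (Suc j) \<in> trefftz_space p" "dgnorm p (\<phi> (Suc j)) = 1" using \<phi>[OF S] by auto
    show "(\<lambda>x. E x - Eh j x) \<in> trefftz_space p" "(\<lambda>x. E x - Eh (Suc j) x) \<in> trefftz_space p"
      using diff j by auto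
    fix b
    \<comment> \<open>The two copies of \<open>E\<close> cancel, which leaves a test field in the
      new span.\<close>
    have "(\<lambda>x. E x - Eh j x - of_real b *s \<phi> (Suc j) x - (E x - Eh (Suc j) x))
        = (\<lambda>x. of_real (- b) *s \<phi> (Suc j) x + ((-1) *s Eh j x + Eh (Suc j) x))" (is "?w = _")
      by (simp add: vec_eq_iff fun_eq_iff)
    also have "\<dots> \<in> cspan \<phi> (Suc j)"
      using Eh_span[of j] Eh_span[of "Suc j"] cspan_Suc[of \<phi> j] j
      by (intro cspan_lincomb cspan_self) auto
    finally have w: "?w \<in> cspan \<phi> (Suc j)" .
    \<comment> \<open>Galerkin orthogonality: on this test field the discrete and the continuous
      equation have the same right-hand side.\<close>
    have "aform p (\<lambda>x. E x - Eh (Suc j) x) ?w = (-1) * aform p (Eh (Suc j)) ?w + aform p E ?w"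
      unfolding diff_eq[of E "Eh (Suc j)"]
      by (rule aform_lincomb[OF p _ E(1)]) (use Eh(1)[OF S] w span[OF j] in auto)
    also have "\<dots> = 0" using Eh(2)[OF S w] E(2) w span[OF j] by auto
    finally show "aform p (\<lambda>x. E x - Eh (Suc j) x) ?w = 0" .
  qed
  \<comment> \<open>The induction starts at one step, because for the empty product the strict
    inequality would be false.\<close>
  have "dgnorm p (\<lambda>x. E x - Eh (Suc m) x) < dgnorm p (\<lambda>x. E x - Eh 0 x) * (\<Prod>j=1..Suc m. \<epsilon> j)"
    if "Suc m \<le> i" for m
    using that
  proof (induction m)
    case 0
    then show ?case using step[of 0] by simp
  next
    case (Suc m)
    have "dgnorm p (\<lambda>x. E x - Eh (Suc (Suc m)) x) < dgnorm p (\<lambda>x. E x - Eh (Suc m) x) * \<epsilon> (Suc (Suc m))"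
      by (rule step[OF Suc.prems])
    also have "\<dots> < dgnorm p (\<lambda>x. E x - Eh 0 x) * (\<Prod>j=1..Suc m. \<epsilon> j) * \<epsilon> (Suc (Suc m))"
      using Suc assms(4) by (intro mult_strict_right_mono) auto
    finally show ?case by (simp add: mult.assoc prod.nat_ivl_Suc')
  qed
  from this[of "i - 1"] assms(3) show ?thesis by simp
qed

end
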